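(* Let $X$ and $Y$ be uniformly locally finite metric spaces and $\Phi:\mathrm{C}^*_u(X)\to\mathrm{C}^*_u(Y)$ an embedding. The following are equivalent: (1) $\Phi$ is spatially implemented by an isometric embedding, i.e. there is an isometry $u:\ell_2(X)\to\ell_2(Y)$ with $\Phi(a)=uau^*$ for all $a\in\mathrm{C}^*_u(X)$; (2) $\Phi$ is rank-preserving and strongly continuous; (3) $\Phi(1_X)\mathcal K(\ell_2(Y))\Phi(1_X)\subset\Phi(\mathrm{C}^*_u(X))$; (4) there is a closed subspace $H'\subset\ell_2(Y)$ such that $\mathcal K(H')\subset\Phi(\mathrm{C}^*_u(X))$ and $\mathcal K(H')$ is an essential ideal of the hereditary $\mathrm{C}^*$-subalgebra of $\mathrm{C}^*_u(Y)$ generated by $\Phi(\mathrm{C}^*_u(X))$.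
   Context: $\mathrm{C}^*_u(X)$: norm closure in $\mathcal B(\ell_2(X))$ of finite-propagation operators. Embedding = injective $*$-homomorphism. Rank-preserving: $\mathrm{rank}\,\Phi(a)=\mathrm{rank}\,a$ for all $a$. Strongly continuous: continuous for the strong operator topology on bounded sets. $1_X$ is the identity on $\ell_2(X)$, $\mathcal K(H)$ the compact operators on $H$ (regarded inside $\mathcal B(\ell_2(Y))$ for $H\subset\ell_2(Y)$). *)

theory Defs
  imports "HOL-Analysis.Analysis" "HOL-Library.Extended_Nat"
begin

type_synonym 'a vec = "'a \<Rightarrow> complex"
type_synonym ('a, 'b) op = "'a vec \<Rightarrow> 'b vec"

definition l2 :: "'a vec set" where
  "l2 = {f. (\<lambda>x. (cmod (f x))\<^sup>2) summable_on UNIV}"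

definition l2_norm :: "'a vec \<Rightarrow> real" where
  "l2_norm f = sqrt (\<Sum>\<^sub>\<infinity>x. (cmod (f x))\<^sup>2)"

definition l2_inner :: "'a vec \<Rightarrow> 'a vec \<Rightarrow> complex" where
  "l2_inner f g = (\<Sum>\<^sub>\<infinity>x. cnj (f x) * g x)"

definition vzero :: "'a vec" where "vzero = (\<lambda>_. 0)"
definition vadd :: "'a vec \<Rightarrow> 'a vec \<Rightarrow> 'a vec" where "vadd f g = (\<lambda>x. f x + g x)"
definition vsub :: "'a vec \<Rightarrow> 'a vec \<Rightarrow> 'a vec" where "vsub f g = (\<lambda>x. f x - g x)"
definition vscale :: "complex \<Rightarrow> 'a vec \<Rightarrow> 'a vec" where "vscale c f = (\<lambda>x. c * f x)"

text \<open>Bounded linear operators ell_2(A) -> ell_2(B). An operator is normalised to be 0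
  outside ell_2(A), so that HOL equality of functions is equality of operators.\<close>
definition bounded_op :: "('a, 'b) op \<Rightarrow> bool" where
  "bounded_op T \<longleftrightarrow>
     (\<forall>f\<in>l2. T f \<in> l2) \<and>
     (\<forall>f\<in>l2. \<forall>g\<in>l2. T (vadd f g) = vadd (T f) (T g)) \<and>
     (\<forall>c. \<forall>f\<in>l2. T (vscale c f) = vscale c (T f)) \<and>
     (\<exists>C. \<forall>f\<in>l2. l2_norm (T f) \<le> C * l2_norm f) \<and>
     (\<forall>f. f \<notin> l2 \<longrightarrow> T f = vzero)"

definition op_norm :: "('a, 'b) op \<Rightarrow> real" where
  "op_norm T = Sup ((\<lambda>f. l2_norm (T f)) ` {f\<in>l2. l2_norm f \<le> 1})"

definition op_zero :: "('a, 'b) op" where "op_zero = (\<lambda>_. vzero)"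
definition op_add :: "('a, 'b) op \<Rightarrow> ('a, 'b) op \<Rightarrow> ('a, 'b) op" where
  "op_add S T = (\<lambda>f. vadd (S f) (T f))"
definition op_sub :: "('a, 'b) op \<Rightarrow> ('a, 'b) op \<Rightarrow> ('a, 'b) op" where
  "op_sub S T = (\<lambda>f. vsub (S f) (T f))"
definition op_scale :: "complex \<Rightarrow> ('a, 'b) op \<Rightarrow> ('a, 'b) op" where
  "op_scale c T = (\<lambda>f. vscale c (T f))"

definition id_op :: "('a, 'a) op" where
  "id_op = (\<lambda>f. if f \<in> l2 then f else vzero)"

definition adj :: "('a, 'b) op \<Rightarrow> ('b, 'a) op" where
  "adj T = (\<lambda>g. if g \<in> l2
        then (THE h. h \<in> l2 \<and> (\<forall>f\<in>l2. l2_inner (T f) g = l2_inner f h))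
        else vzero)"

definition delta :: "'a \<Rightarrow> 'a vec" where
  "delta x = (\<lambda>z. if z = x then 1 else 0)"

definition finite_prop :: "('a::metric_space, 'a) op \<Rightarrow> bool" where
  "finite_prop T \<longleftrightarrow> (\<exists>r. \<forall>x y. dist x y > r \<longrightarrow> T (delta x) y = 0)"

definition roe_alg :: "('a::metric_space, 'a) op set" where
  "roe_alg = {T. bounded_op T \<and>
     (\<forall>\<epsilon>>0. \<exists>S. bounded_op S \<and> finite_prop S \<and> op_norm (op_sub T S) < \<epsilon>)}"

definition unif_locally_finite :: "'a::metric_space set \<Rightarrow> bool" where
  "unif_locally_finite S \<longleftrightarrow>
     (\<forall>r. \<exists>N::nat. \<forall>x\<in>S. finite (cball x r \<inter> S) \<and> card (cball x r \<inter> S) \<le> N)"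

definition roe_embedding :: "(('a::metric_space, 'a) op \<Rightarrow> ('b::metric_space, 'b) op) \<Rightarrow> bool" where
  "roe_embedding \<Phi> \<longleftrightarrow>
     (\<forall>a\<in>roe_alg. \<Phi> a \<in> roe_alg) \<and>
     (\<forall>a\<in>roe_alg. \<forall>b\<in>roe_alg. \<Phi> (op_add a b) = op_add (\<Phi> a) (\<Phi> b)) \<and>
     (\<forall>c. \<forall>a\<in>roe_alg. \<Phi> (op_scale c a) = op_scale c (\<Phi> a)) \<and>
     (\<forall>a\<in>roe_alg. \<forall>b\<in>roe_alg. \<Phi> (a \<circ> b) = \<Phi> a \<circ> \<Phi> b) \<and>
     (\<forall>a\<in>roe_alg. \<Phi> (adj a) = adj (\<Phi> a)) \<and>
     inj_on \<Phi> roe_alg"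

definition l2_isometry :: "('a, 'b) op \<Rightarrow> bool" where
  "l2_isometry u \<longleftrightarrow> bounded_op u \<and> (\<forall>f\<in>l2. l2_norm (u f) = l2_norm f)"

definition cspan :: "'a vec set \<Rightarrow> 'a vec set" where
  "cspan F = {g. \<exists>c. g = (\<lambda>y. \<Sum>f\<in>F. c f * f y)}"

definition op_rank :: "('a, 'b) op \<Rightarrow> enat" where
  "op_rank T = (if \<exists>F. finite F \<and> T ` l2 \<subseteq> cspan F
      then enat (LEAST n. \<exists>F. finite F \<and> card F = n \<and> T ` l2 \<subseteq> cspan F)
      else \<infinity>)"

definition rank_preserving :: "(('a, 'a) op \<Rightarrow> ('b, 'b) op) \<Rightarrow> ('a, 'a) op set \<Rightarrow> bool" where
  "rank_preserving \<Phi> A \<longleftrightarrow> (\<forall>a\<in>A. op_rank (\<Phi> a) = op_rank a)"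

definition sot_tendsto :: "('i \<Rightarrow> ('a, 'b) op) \<Rightarrow> ('a, 'b) op \<Rightarrow> 'i filter \<Rightarrow> bool" where
  "sot_tendsto A a F \<longleftrightarrow> (\<forall>f\<in>l2. ((\<lambda>i. l2_norm (vsub (A i f) (a f))) \<longlongrightarrow> 0) F)"

text \<open>Continuity for the SOT on every bounded subset {a in A. norm a <= R}
  (filter characterisation of topological continuity of the restriction).\<close>
definition strongly_continuous :: "(('a, 'a) op \<Rightarrow> ('b, 'b) op) \<Rightarrow> ('a, 'a) op set \<Rightarrow> bool" where
  "strongly_continuous \<Phi> A \<longleftrightarrow>
     (\<forall>R a. a \<in> A \<and> op_norm a \<le> R \<longrightarrow>
        (\<forall>F :: ('a, 'a) op filter.
           (\<forall>\<^sub>F b in F. b \<in> A \<and> op_norm b \<le> R) \<and> sot_tendsto id a F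
           \<longrightarrow> sot_tendsto \<Phi> (\<Phi> a) F))"

text \<open>Compact operators: the image of the unit ball is relatively compact, i.e.
  (ell_2 being complete) totally bounded.\<close>
definition compact_op :: "('a, 'b) op \<Rightarrow> bool" where
  "compact_op T \<longleftrightarrow> bounded_op T \<and>
     (\<forall>\<epsilon>>0. \<exists>F. finite F \<and> F \<subseteq> l2 \<and>
        (\<forall>f\<in>l2. l2_norm f \<le> 1 \<longrightarrow> (\<exists>g\<in>F. l2_norm (vsub (T f) g) < \<epsilon>)))"

definition closed_l2_subspace :: "'a vec set \<Rightarrow> bool" where
  "closed_l2_subspace H \<longleftrightarrow> H \<subseteq> l2 \<and> vzero \<in> H \<and>
     (\<forall>f\<in>H. \<forall>g\<in>H. vadd f g \<in> H) \<and> (\<forall>c. \<forall>f\<in>H. vscale c f \<in> H) \<and>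
     (\<forall>s g. (\<forall>n. s n \<in> H) \<and> g \<in> l2 \<and> (\<lambda>n. l2_norm (vsub (s n) g)) \<longlonglongrightarrow> 0 \<longrightarrow> g \<in> H)"

text \<open>K(H) regarded inside B(ell_2(Y)): compact operators k = P k P, P the projection onto H.\<close>
definition compacts_on :: "'a vec set \<Rightarrow> ('a, 'a) op set" where
  "compacts_on H = {k. compact_op k \<and> k ` l2 \<subseteq> H \<and>
      (\<forall>f\<in>l2. (\<forall>h\<in>H. l2_inner h f = 0) \<longrightarrow> k f = vzero)}"

definition cstar_subalg :: "('a, 'a) op set \<Rightarrow> bool" where
  "cstar_subalg B \<longleftrightarrow> (\<forall>b\<in>B. bounded_op b) \<and> op_zero \<in> B \<and>
     (\<forall>a\<in>B. \<forall>b\<in>B. op_add a b \<in> B \<and> a \<circ> b \<in> B) \<and>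
     (\<forall>c. \<forall>a\<in>B. op_scale c a \<in> B) \<and> (\<forall>a\<in>B. adj a \<in> B) \<and>
     (\<forall>T. bounded_op T \<and> (\<forall>\<epsilon>>0. \<exists>S\<in>B. op_norm (op_sub T S) < \<epsilon>) \<longrightarrow> T \<in> B)"

definition positive_op :: "('a, 'a) op \<Rightarrow> bool" where
  "positive_op a \<longleftrightarrow> bounded_op a \<and>
     (\<forall>f\<in>l2. Im (l2_inner f (a f)) = 0 \<and> Re (l2_inner f (a f)) \<ge> 0)"

definition op_le :: "('a, 'a) op \<Rightarrow> ('a, 'a) op \<Rightarrow> bool" where
  "op_le a b \<longleftrightarrow> positive_op (op_sub b a)"

definition hereditary_subalg :: "('a, 'a) op set \<Rightarrow> ('a, 'a) op set \<Rightarrow> bool" where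
  "hereditary_subalg A B \<longleftrightarrow> cstar_subalg B \<and> B \<subseteq> A \<and>
     (\<forall>a\<in>A. \<forall>b\<in>B. op_le op_zero a \<and> op_le a b \<longrightarrow> a \<in> B)"

definition hereditary_gen :: "('a, 'a) op set \<Rightarrow> ('a, 'a) op set \<Rightarrow> ('a, 'a) op set" where
  "hereditary_gen A S = \<Inter>{B. hereditary_subalg A B \<and> S \<subseteq> B}"

definition is_ideal :: "('a, 'a) op set \<Rightarrow> ('a, 'a) op set \<Rightarrow> bool" where
  "is_ideal J D \<longleftrightarrow> J \<subseteq> D \<and> op_zero \<in> J \<and>
     (\<forall>j\<in>J. \<forall>k\<in>J. op_add j k \<in> J) \<and> (\<forall>c. \<forall>j\<in>J. op_scale c j \<in> J) \<and>
     (\<forall>j\<in>J. \<forall>d\<in>D. d \<circ> j \<in> J \<and> j \<circ> d \<in> J)"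

definition essential_ideal :: "('a, 'a) op set \<Rightarrow> ('a, 'a) op set \<Rightarrow> bool" where
  "essential_ideal J D \<longleftrightarrow> is_ideal J D \<and>
     (\<forall>d\<in>D. (\<forall>j\<in>J. d \<circ> j = op_zero) \<longrightarrow> d = op_zero)"

end

theory Submission
  imports Defs "HOL-Library.Function_Algebras"
begin

text \<open>
  Write \<open>p = \<Phi> id_op\<close> and \<open>e x\<close> for the projection onto the line of \<open>delta x\<close>. If \<open>h\<close> is a
  vector with \<open>\<Phi> (e x) h \<noteq> 0\<close>, then \<open>\<xi> \<mapsto> \<Phi> (rank1 \<xi> (delta x)) h\<close> is a multiple of an isometry
  \<open>u\<close> with \<open>\<Phi> a \<circ> u = u \<circ> a\<close>, and \<open>u\<close> implements \<open>\<Phi>\<close> as soon as its range is the range of \<open>p\<close>.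
  Conditions (2) and (4) both force this. Under (2), each \<open>\<Phi> (e y)\<close> has rank one, so its range is spanned by
  \<open>u (delta y)\<close>, and strong continuity gives that the \<open>\<Phi> (e y)\<close> sum to \<open>p\<close>. Under (4), choosing
  \<open>h\<close> in \<open>H\<close> puts \<open>H\<close> inside the range of \<open>u\<close>; a vector \<open>w\<close> in the range of \<open>p\<close> orthogonal to it
  would give the operator \<open>rank1 w w \<le> (l2_norm w)\<^sup>2 p\<close> in the hereditary subalgebra annihilating the
  compacts on \<open>H\<close>. Conversely (1) implies (3) because compact operators lie in the uniform Roe
  algebra, and (3) implies (4) with \<open>H\<close> the range of \<open>p\<close>.
\<close>

text \<open>Two obstructions separate a general embedding from a spatial one. The rank one operators
  may act through several copies of the identity representation, and a further part of the range of
  \<open>p\<close> may be annihilated by the images of all of them. Both show up in the same way: as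
  a nonzero vector fixed by \<open>p\<close> and orthogonal to one chosen copy. A single criterion
  about such vectors therefore serves (2) and (4). One copy can be chosen because
  \<open>adj (rank1 \<xi> (delta x)) \<circ> rank1 \<xi> (delta x)\<close> is a multiple of
  \<open>e x\<close> that sees \<open>\<xi>\<close> only through its norm. Under (4) the copy
  absorbs \<open>H\<close> because an operator \<open>rank1 g h\<close> in the range of
  \<open>\<Phi>\<close>, applied to \<open>\<Phi> (e x) h\<close>, is at once a multiple of
  \<open>g\<close> and a vector of the copy. The generated hereditary subalgebra is an intersection
  and is never computed. It is bracketed: from above by the corner cut out by \<open>p\<close>, from
  below by the range of \<open>\<Phi>\<close> and the operators \<open>rank1 w w\<close> with
  \<open>p w = w\<close>.\<close>

lemma vadd_eq_plus [simp]: "vadd f g = f + g"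
  by (auto simp: vadd_def)

lemma vsub_eq_minus [simp]: "vsub f g = f - g"
  by (auto simp: vsub_def)

lemma vzero_eq_zero [simp]: "vzero = 0"
  by (auto simp: vzero_def)

lemma op_add_eq_plus [simp]: "op_add S T = S + T"
  by (auto simp: op_add_def)

lemma op_sub_eq_minus [simp]: "op_sub S T = S - T"
  by (auto simp: op_sub_def)

lemma op_zero_eq_zero [simp]: "op_zero = 0"
  by (auto simp: op_zero_def)

lemma vscale_apply [simp]: "vscale c f x = c * f x"
  by (simp add: vscale_def)

lemma op_scale_apply [simp]: "op_scale c T f = vscale c (T f)"
  by (simp add: op_scale_def)

text \<open>Besides the scaling laws this supplies \<open>vs.span\<close> and
  \<open>vs.independent\<close>, on which the treatment of rank rests.\<close>

interpretation vs: vector_space "vscale :: complex \<Rightarrow> 'a vec \<Rightarrow> 'a vec"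
  by unfold_locales (auto simp: fun_eq_iff algebra_simps)

subsection \<open>The Hilbert space of square summable families\<close>

lemma summable_square_norm: "f \<in> l2 \<Longrightarrow> (\<lambda>x. (cmod (f x))\<^sup>2) summable_on UNIV"
  by (simp add: l2_def)

lemma l2_comparison:
  assumes "g \<in> l2" and "\<And>x. cmod (f x) \<le> cmod (g x)"
  shows "f \<in> l2"
  unfolding l2_def
proof (rule CollectI, rule summable_on_comparison_test)
  show "(\<lambda>x. (cmod (g x))\<^sup>2) summable_on UNIV"
    using assms(1) by (rule summable_square_norm)
qed (use assms(2) in \<open>auto intro: power_mono\<close>)

text \<open>Comes from expanding the square of \<open>cmod a - cmod b\<close>. The lossy factor 2 is
  harmless, as the bound serves summability.\<close>

lemma square_norm_sum_le: "(cmod (a + b))\<^sup>2 \<le> 2 * (cmod a)\<^sup>2 + 2 * (cmod b)\<^sup>2"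
proof -
  have "(cmod (a + b))\<^sup>2 \<le> (cmod a + cmod b)\<^sup>2"
    by (intro power_mono norm_triangle_ineq) auto
  also have "\<dots> \<le> 2 * (cmod a)\<^sup>2 + 2 * (cmod b)\<^sup>2"
    using zero_le_power2[of "cmod a - cmod b"] by (simp add: power2_eq_square algebra_simps)
  finally show ?thesis .
qed

lemma l2_add [simp, intro]:
  assumes "f \<in> l2" "g \<in> l2" shows "f + g \<in> l2"
  unfolding l2_def
proof (rule CollectI, rule summable_on_comparison_test)
  show "(\<lambda>x. 2 * (cmod (f x))\<^sup>2 + 2 * (cmod (g x))\<^sup>2) summable_on UNIV"
    using assms by (intro summable_on_add summable_on_cmult_right summable_square_norm)
qed (auto simp: square_norm_sum_le)

lemma l2_zero [simp, intro]: "0 \<in> l2"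
  by (simp add: l2_def)

lemma l2_scale [simp, intro]: "f \<in> l2 \<Longrightarrow> vscale c f \<in> l2"
  by (simp add: l2_def norm_mult power_mult_distrib summable_on_cmult_right)

lemma l2_uminus [simp, intro]: "f \<in> l2 \<Longrightarrow> - f \<in> l2"
  by (simp add: l2_def)

lemma l2_diff [simp, intro]: "f \<in> l2 \<Longrightarrow> g \<in> l2 \<Longrightarrow> f - g \<in> l2"
  using l2_add[of f "- g"] l2_uminus by simp

lemma l2_sum [intro]: "(\<And>i. i \<in> I \<Longrightarrow> f i \<in> l2) \<Longrightarrow> sum f I \<in> l2"
  by (induction I rule: infinite_finite_induct) auto

text \<open>The products are dominated by the summable squares, by the inequality between arithmetic
  and geometric means.\<close>

lemma summable_inner:
  assumes "f \<in> l2" "g \<in> l2"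
  shows "(\<lambda>x. cnj (f x) * g x) summable_on UNIV"
proof (rule abs_summable_summable, rule summable_on_comparison_test)
  show "(\<lambda>x. (cmod (f x))\<^sup>2 + (cmod (g x))\<^sup>2) summable_on UNIV"
    using assms by (intro summable_on_add summable_square_norm)
  show "norm (cnj (f x) * g x) \<le> (cmod (f x))\<^sup>2 + (cmod (g x))\<^sup>2" for x
  proof -
    have "2 * (cmod (f x) * cmod (g x)) \<le> (cmod (f x))\<^sup>2 + (cmod (g x))\<^sup>2"
      using zero_le_power2[of "cmod (f x) - cmod (g x)"] by (simp add: power2_diff algebra_simps)
    moreover have "0 \<le> cmod (f x) * cmod (g x)" by simp
    ultimately show ?thesis unfolding norm_mult complex_mod_cnj by linarith
  qed
qed auto

lemma l2_inner_add_right: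
  "f \<in> l2 \<Longrightarrow> g \<in> l2 \<Longrightarrow> h \<in> l2 \<Longrightarrow> l2_inner f (g + h) = l2_inner f g + l2_inner f h"
  by (simp add: l2_inner_def distrib_left infsum_add summable_inner)

lemma l2_inner_scale_right: "l2_inner f (vscale c g) = c * l2_inner f g"
proof -
  have "l2_inner f (vscale c g) = (\<Sum>\<^sub>\<infinity>x. c * (cnj (f x) * g x))"
    unfolding l2_inner_def by (simp add: mult_ac)
  thus ?thesis by (simp add: infsum_cmult_right' l2_inner_def)
qed

lemma l2_inner_commute: "l2_inner g f = cnj (l2_inner f g)"
  by (simp add: l2_inner_def mult.commute flip: infsum_cnj)

lemma l2_inner_add_left:
  "f \<in> l2 \<Longrightarrow> g \<in> l2 \<Longrightarrow> h \<in> l2 \<Longrightarrow> l2_inner (f + g) h = l2_inner f h + l2_inner g h"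
  by (simp add: l2_inner_commute[of _ h] l2_inner_add_right)

lemma l2_inner_scale_left: "l2_inner (vscale c f) g = cnj c * l2_inner f g"
  by (simp add: l2_inner_commute[of _ g] l2_inner_scale_right)

lemma l2_inner_zero [simp]: "l2_inner 0 f = 0" "l2_inner f 0 = 0"
  by (simp_all add: l2_inner_def)

lemma l2_inner_uminus [simp]:
  "l2_inner (- f) g = - l2_inner f g" "l2_inner f (- g) = - l2_inner f g"
  by (simp_all add: l2_inner_def infsum_uminus)

lemma l2_inner_diff_right:
  "f \<in> l2 \<Longrightarrow> g \<in> l2 \<Longrightarrow> h \<in> l2 \<Longrightarrow> l2_inner f (g - h) = l2_inner f g - l2_inner f h"
  using l2_inner_add_right[of f g "- h"] by simp

lemma l2_inner_diff_left:
  "f \<in> l2 \<Longrightarrow> g \<in> l2 \<Longrightarrow> h \<in> l2 \<Longrightarrow> l2_inner (f - g) h = l2_inner f h - l2_inner g h"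
  using l2_inner_add_left[of f "- g" h] by simp

lemmas l2_inner_simps =
  l2_inner_add_left l2_inner_add_right l2_inner_diff_left l2_inner_diff_right
  l2_inner_scale_left l2_inner_scale_right

lemma l2_norm_nonneg [simp]: "0 \<le> l2_norm f"
  by (simp add: l2_norm_def infsum_nonneg)

lemma l2_norm_square: "(l2_norm f)\<^sup>2 = (\<Sum>\<^sub>\<infinity>x. (cmod (f x))\<^sup>2)"
  by (simp add: l2_norm_def infsum_nonneg)

text \<open>\<open>Re\<close> inverts \<open>of_real\<close>, so the real and the complex series are
  summable together; if they are not, both infinite sums are 0 by convention.\<close>

lemma l2_inner_self: "l2_inner f f = of_real ((l2_norm f)\<^sup>2)"
proof -
  have "cnj (f x) * f x = of_real ((cmod (f x))\<^sup>2)" for x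
    using complex_norm_square[of "f x"] by (simp add: mult.commute)
  thus ?thesis
    unfolding l2_inner_def l2_norm_square
    using infsum_bounded_linear_strong[where h=complex_of_real and A=UNIV and
        f="\<lambda>x. (cmod (f x))\<^sup>2", OF summable_on_bounded_linear_iff[where h'=Re]]
    by (simp add: bounded_linear_of_real bounded_linear_Re)
qed

lemma l2_norm_square_Re: "(l2_norm f)\<^sup>2 = Re (l2_inner f f)"
  by (simp add: l2_inner_self)

lemma l2_norm_zero [simp]: "l2_norm 0 = 0"
  by (simp add: l2_norm_def)

lemma l2_norm_eq_zero_iff [simp]:
  assumes "f \<in> l2" shows "l2_norm f = 0 \<longleftrightarrow> f = 0"
proof
  assume "l2_norm f = 0"
  hence *: "(\<Sum>\<^sub>\<infinity>x. (cmod (f x))\<^sup>2) = 0"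
    using l2_norm_square[of f] by simp
  have "(cmod (f x))\<^sup>2 = 0" for x
    by (rule nonneg_infsum_le_0D[where A=UNIV]) (use * assms summable_square_norm in auto)
  thus "f = 0" by (auto simp: fun_eq_iff)
qed simp

lemma l2_norm_pos_iff: "f \<in> l2 \<Longrightarrow> 0 < l2_norm f \<longleftrightarrow> f \<noteq> 0"
  using l2_norm_nonneg[of f] by (auto simp: less_le)

lemma l2_norm_scale [simp]: "l2_norm (vscale c f) = cmod c * l2_norm f"
proof (rule power2_eq_imp_eq)
  show "(l2_norm (vscale c f))\<^sup>2 = (cmod c * l2_norm f)\<^sup>2"
    by (simp add: l2_norm_square power_mult_distrib norm_mult infsum_cmult_right')
qed auto

lemma l2_norm_uminus [simp]: "l2_norm (- f) = l2_norm f"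
  by (simp add: l2_norm_def)

lemma l2_norm_minus_commute: "l2_norm (f - g) = l2_norm (g - f)"
  using l2_norm_uminus[of "f - g"] by simp

lemma l2_Cauchy_Schwarz:
  assumes f: "f \<in> l2" and g: "g \<in> l2"
  shows "cmod (l2_inner f g) \<le> l2_norm f * l2_norm g"
proof (cases "f = 0")
  case False
  define n where "n = (l2_norm f)\<^sup>2"
  have n: "n > 0" using False f by (simp add: n_def l2_norm_pos_iff)
  define c where "c = l2_inner f g"
  \<comment> \<open>The component of \<open>g\<close> orthogonal to \<open>f\<close>. Once expanded,
    the nonnegativity of its squared norm is the inequality.\<close>
  define h where "h = g - vscale (c / of_real n) f"
  have h: "h \<in> l2" using f g by (simp add: h_def)
  have "l2_inner f h = 0"
    using f g n l2_inner_self[of f] by (simp add: h_def l2_inner_simps flip: c_def n_def)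
  moreover have "l2_inner h h = l2_inner g h - cnj (c / of_real n) * l2_inner f h"
    using f g h by (subst h_def) (simp add: l2_inner_simps)
  moreover have "l2_inner g h = of_real ((l2_norm g)\<^sup>2) - c / of_real n * cnj c"
    using f g l2_inner_self[of g] l2_inner_commute[of g f] by (simp add: h_def l2_inner_simps c_def)
  ultimately have "of_real ((l2_norm h)\<^sup>2) = of_real ((l2_norm g)\<^sup>2) - c / of_real n * cnj c"
    using l2_inner_self[of h] by simp
  also have "\<dots> = complex_of_real ((l2_norm g)\<^sup>2 - (cmod c)\<^sup>2 / n)"
    using complex_norm_square[of c] by simp
  finally have "(l2_norm h)\<^sup>2 = (l2_norm g)\<^sup>2 - (cmod c)\<^sup>2 / n"
    using of_real_eq_iff by blast
  hence "(cmod c)\<^sup>2 / n \<le> (l2_norm g)\<^sup>2" using zero_le_power2[of "l2_norm h"] by linarith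
  hence "(cmod c)\<^sup>2 \<le> (l2_norm f * l2_norm g)\<^sup>2"
    using n by (simp add: field_simps power_mult_distrib n_def)
  thus ?thesis unfolding c_def by (rule power2_le_imp_le) simp
qed simp

lemma l2_norm_triangle:
  assumes "f \<in> l2" "g \<in> l2"
  shows "l2_norm (f + g) \<le> l2_norm f + l2_norm g"
proof (rule power2_le_imp_le)
  have "(l2_norm (f + g))\<^sup>2 = (l2_norm f)\<^sup>2 + (l2_norm g)\<^sup>2 + 2 * Re (l2_inner f g)"
    using assms l2_inner_commute[of g f]
    by (simp add: l2_norm_square_Re l2_inner_simps)
  also have "Re (l2_inner f g) \<le> l2_norm f * l2_norm g"
    using complex_Re_le_cmod l2_Cauchy_Schwarz[OF assms] order_trans by blast
  finally show "(l2_norm (f + g))\<^sup>2 \<le> (l2_norm f + l2_norm g)\<^sup>2"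
    by (simp add: power2_sum algebra_simps)
qed simp

lemma l2_norm_triangle_diff:
  assumes "f \<in> l2" "g \<in> l2" "h \<in> l2"
  shows "l2_norm (f - h) \<le> l2_norm (f - g) + l2_norm (g - h)"
  using l2_norm_triangle[of "f - g" "g - h"] assms by simp

section \<open>Basis vectors and truncations\<close>

lemma delta_l2 [simp, intro]: "delta x \<in> l2"
proof -
  have "(\<lambda>y. (cmod (delta x y))\<^sup>2) summable_on {x}" by simp
  hence "(\<lambda>y. (cmod (delta x y))\<^sup>2) summable_on UNIV"
    by (rule summable_on_cong_neutral[THEN iffD1, rotated -1]) (auto simp: delta_def)
  thus ?thesis by (simp add: l2_def)
qed

lemma l2_inner_delta [simp]: "l2_inner (delta x) f = f x"
proof -
  have "l2_inner (delta x) f = (\<Sum>\<^sub>\<infinity>y\<in>{x}. cnj (delta x y) * f y)"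
    unfolding l2_inner_def by (rule infsum_cong_neutral) (auto simp: delta_def)
  thus ?thesis by (simp add: delta_def)
qed

lemma delta_same [simp]: "delta x x = 1"
  by (simp add: delta_def)

lemma l2_norm_delta [simp]: "l2_norm (delta x) = 1"
  using l2_norm_square_Re[of "delta x"] l2_norm_nonneg[of "delta x"]
  by (auto simp: power2_eq_1_iff)

lemma delta_nonzero [simp]: "delta x \<noteq> 0"
  using l2_norm_delta[of x] by force

lemma l2_eqI_inner:
  assumes "\<And>f. f \<in> l2 \<Longrightarrow> l2_inner f g = l2_inner f h"
  shows "g = h"
  using assms[OF delta_l2] by auto

text \<open>Defined on all functions rather than on \<open>l2\<close>, because the Riesz argument
  below truncates a vector before it is known to be square summable.\<close>

definition trunc :: "'a set \<Rightarrow> 'a vec \<Rightarrow> 'a vec" where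
  "trunc F f = (\<lambda>x. if x \<in> F then f x else 0)"

lemma trunc_l2 [simp, intro]: "f \<in> l2 \<Longrightarrow> trunc F f \<in> l2"
  by (rule l2_comparison) (auto simp: trunc_def)

lemma sum_fun_apply: "(\<Sum>i\<in>I. f i) x = (\<Sum>i\<in>I. f i x)"
  by (induction I rule: infinite_finite_induct) auto

lemma trunc_finite_sum: "finite F \<Longrightarrow> trunc F f = (\<Sum>x\<in>F. vscale (f x) (delta x))"
  by (auto simp: trunc_def fun_eq_iff delta_def sum_fun_apply if_distrib cong: if_cong)

lemma trunc_finite_l2 [simp]: "finite F \<Longrightarrow> trunc F f \<in> l2"
  by (auto simp: trunc_finite_sum)

lemma l2_norm_trunc_square: "(l2_norm (trunc F f))\<^sup>2 = (\<Sum>\<^sub>\<infinity>x\<in>F. (cmod (f x))\<^sup>2)"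
  unfolding l2_norm_square by (rule infsum_cong_neutral) (auto simp: trunc_def)

lemma l2_norm_trunc_le: "f \<in> l2 \<Longrightarrow> l2_norm (trunc F f) \<le> l2_norm f"
  unfolding l2_norm_def real_sqrt_le_iff
  by (intro infsum_mono summable_square_norm trunc_l2) (auto simp: trunc_def)

lemma l2_norm_diff_trunc_square:
  assumes "f \<in> l2"
  shows "(l2_norm (f - trunc F f))\<^sup>2 = (l2_norm f)\<^sup>2 - (\<Sum>\<^sub>\<infinity>x\<in>F. (cmod (f x))\<^sup>2)"
proof -
  have "f - trunc F f = trunc (- F) f" by (auto simp: trunc_def fun_eq_iff)
  hence "(l2_norm (f - trunc F f))\<^sup>2 = (\<Sum>\<^sub>\<infinity>x\<in>UNIV - F. (cmod (f x))\<^sup>2)"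
    by (simp add: l2_norm_trunc_square Compl_eq_Diff_UNIV)
  also have "\<dots> = (l2_norm f)\<^sup>2 - (\<Sum>\<^sub>\<infinity>x\<in>F. (cmod (f x))\<^sup>2)"
    using summable_square_norm[OF assms] unfolding l2_norm_square
    by (intro infsum_Diff summable_on_subset_banach[of _ UNIV F]) auto
  finally show ?thesis .
qed

text \<open>By Pythagoras the squared error is the squared norm minus a partial sum of the squares,
  and the finite subsets form the net along which \<open>infsum\<close> converges.\<close>

lemma trunc_tendsto:
  assumes "f \<in> l2"
  shows "((\<lambda>F. l2_norm (f - trunc F f)) \<longlongrightarrow> 0) (finite_subsets_at_top UNIV)"
proof -
  have "((\<lambda>F. sum (\<lambda>x. (cmod (f x))\<^sup>2) F) \<longlongrightarrow> (l2_norm f)\<^sup>2) (finite_subsets_at_top UNIV)"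
    unfolding l2_norm_square using summable_square_norm[OF assms] by (rule infsum_tendsto)
  hence "((\<lambda>F. sqrt ((l2_norm f)\<^sup>2 - sum (\<lambda>x. (cmod (f x))\<^sup>2) F)) \<longlongrightarrow> sqrt ((l2_norm f)\<^sup>2 - (l2_norm f)\<^sup>2))
      (finite_subsets_at_top UNIV)"
    by (intro tendsto_intros)
  moreover have "\<forall>\<^sub>F F in finite_subsets_at_top UNIV.
      sqrt ((l2_norm f)\<^sup>2 - sum (\<lambda>x. (cmod (f x))\<^sup>2) F) = l2_norm (f - trunc F f)"
  proof (rule eventually_finite_subsets_at_top_weakI)
    fix F :: "'a set" assume "finite F"
    thus "sqrt ((l2_norm f)\<^sup>2 - sum (\<lambda>x. (cmod (f x))\<^sup>2) F) = l2_norm (f - trunc F f)"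
      using l2_norm_diff_trunc_square[OF assms, of F]
      by (intro real_sqrt_unique) auto
  qed
  ultimately show ?thesis by (simp add: filterlim_cong)
qed

subsection \<open>Bounded operators and adjoints\<close>

text \<open>From here on vectors are handled algebraically; the pointwise rules would rewrite them into
  lambda terms to which the lemmas on \<open>l2\<close> no longer apply.\<close>

declare plus_fun_apply [simp del] zero_fun_apply [simp del] minus_apply [simp del]
  uminus_apply [simp del] vscale_apply [simp del]

lemma op_plus_apply [simp]: "(S + T) f = S f + T f" for S T :: "('a, 'b) op"
  by (rule plus_fun_apply)

lemma op_minus_apply [simp]: "(S - T) f = S f - T f" for S T :: "('a, 'b) op"
  by (rule minus_apply)

lemma op_zero_apply [simp]: "(0 :: ('a, 'b) op) f = 0"
  by (rule zero_fun_apply)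

lemma bounded_opI:
  assumes "\<And>f. f \<in> l2 \<Longrightarrow> T f \<in> l2"
    and "\<And>f g. f \<in> l2 \<Longrightarrow> g \<in> l2 \<Longrightarrow> T (f + g) = T f + T g"
    and "\<And>c f. f \<in> l2 \<Longrightarrow> T (vscale c f) = vscale c (T f)"
    and "\<And>f. f \<in> l2 \<Longrightarrow> l2_norm (T f) \<le> C * l2_norm f"
    and "\<And>f. f \<notin> l2 \<Longrightarrow> T f = 0"
  shows "bounded_op T"
  using assms unfolding bounded_op_def by (auto intro!: exI[of _ C])

lemma bounded_op_l2 [simp]: "bounded_op T \<Longrightarrow> f \<in> l2 \<Longrightarrow> T f \<in> l2"
  and bounded_op_add: "bounded_op T \<Longrightarrow> f \<in> l2 \<Longrightarrow> g \<in> l2 \<Longrightarrow> T (f + g) = T f + T g"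
  and bounded_op_scale: "bounded_op T \<Longrightarrow> f \<in> l2 \<Longrightarrow> T (vscale c f) = vscale c (T f)"
  and bounded_op_outside: "bounded_op T \<Longrightarrow> f \<notin> l2 \<Longrightarrow> T f = 0"
  unfolding bounded_op_def by auto

lemma bounded_op_range [simp]: "bounded_op T \<Longrightarrow> T f \<in> l2"
  by (cases "f \<in> l2") (auto simp: bounded_op_outside)

lemma bounded_op_bound:
  assumes "bounded_op T"
  obtains C where "C \<ge> 0" "\<And>f. f \<in> l2 \<Longrightarrow> l2_norm (T f) \<le> C * l2_norm f"
proof -
  obtain C where C: "\<forall>f\<in>l2. l2_norm (T f) \<le> C * l2_norm f"
    using assms unfolding bounded_op_def by blast
  show thesis
  proof (rule that[of "max C 0"])
    fix f :: "'a vec" assume "f \<in> l2"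
    hence "l2_norm (T f) \<le> C * l2_norm f" using C by blast
    also have "\<dots> \<le> max C 0 * l2_norm f" by (rule mult_right_mono) auto
    finally show "l2_norm (T f) \<le> max C 0 * l2_norm f" .
  qed simp
qed

lemma bounded_op_0 [simp]: "bounded_op T \<Longrightarrow> T 0 = 0"
  using bounded_op_scale[of T 0 0] by simp

lemma bounded_op_diff: "bounded_op T \<Longrightarrow> f \<in> l2 \<Longrightarrow> g \<in> l2 \<Longrightarrow> T (f - g) = T f - T g"
  using bounded_op_add[of T "f - g" g] by (simp add: eq_diff_eq)

lemma bounded_op_sum:
  assumes "bounded_op T" "\<And>i. i \<in> I \<Longrightarrow> f i \<in> l2"
  shows "T (\<Sum>i\<in>I. f i) = (\<Sum>i\<in>I. T (f i))"
  using assms(2)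
  by (induction I rule: infinite_finite_induct) (auto simp: assms(1) bounded_op_add l2_sum)

lemma bounded_op_eqI:
  assumes "bounded_op S" "bounded_op T" "\<And>f. f \<in> l2 \<Longrightarrow> S f = T f"
  shows "S = T"
proof
  fix f show "S f = T f"
    using assms by (cases "f \<in> l2") (auto simp: bounded_op_outside)
qed

lemma bounded_op_zero [simp, intro]: "bounded_op 0"
  by (rule bounded_opI[where C=0]) auto

lemma bounded_op_id [simp, intro]: "bounded_op id_op"
  by (rule bounded_opI[where C=1]) (auto simp: id_op_def)

lemma id_op_apply [simp]: "f \<in> l2 \<Longrightarrow> id_op f = f"
  by (simp add: id_op_def)

lemma bounded_op_plus [simp, intro]:
  assumes "bounded_op S" "bounded_op T"
  shows "bounded_op (S + T)"
proof -
  obtain C where C: "\<And>f. f \<in> l2 \<Longrightarrow> l2_norm (S f) \<le> C * l2_norm f"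
    using assms(1) by (rule bounded_op_bound) blast
  obtain D where D: "\<And>f. f \<in> l2 \<Longrightarrow> l2_norm (T f) \<le> D * l2_norm f"
    using assms(2) by (rule bounded_op_bound) blast
  show ?thesis
  proof (rule bounded_opI[where C="C + D"])
    fix f :: "'a vec" assume f: "f \<in> l2"
    show "l2_norm ((S + T) f) \<le> (C + D) * l2_norm f"
      using l2_norm_triangle[of "S f" "T f"] C[OF f] D[OF f] assms f
      by (simp add: distrib_right)
  qed (use assms in \<open>auto simp: bounded_op_add bounded_op_scale bounded_op_outside
        vs.scale_right_distrib\<close>)
qed

lemma bounded_op_scaled [simp, intro]:
  assumes "bounded_op T" shows "bounded_op (op_scale c T)"
proof -
  obtain C where C: "\<And>f. f \<in> l2 \<Longrightarrow> l2_norm (T f) \<le> C * l2_norm f"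
    using assms by (rule bounded_op_bound) blast
  show ?thesis
  proof (rule bounded_opI[where C="cmod c * C"])
    fix f :: "'a vec" assume f: "f \<in> l2"
    show "l2_norm (op_scale c T f) \<le> cmod c * C * l2_norm f"
      using mult_left_mono[OF C[OF f], of "cmod c"] by (simp add: mult.assoc)
  qed (use assms in \<open>auto simp: bounded_op_add bounded_op_scale bounded_op_outside
        vs.scale_right_distrib mult.commute\<close>)
qed

lemma op_diff_conv_scale: "S - T = S + op_scale (-1) T"
  by (simp add: fun_eq_iff)

lemma bounded_op_minus [simp, intro]:
  "bounded_op S \<Longrightarrow> bounded_op T \<Longrightarrow> bounded_op (S - T)"
  unfolding op_diff_conv_scale by (intro bounded_op_plus bounded_op_scaled)

lemma bounded_op_comp [simp, intro]:
  assumes "bounded_op S" "bounded_op T"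
  shows "bounded_op (S \<circ> T)"
proof -
  obtain C where C: "C \<ge> 0" "\<And>f. f \<in> l2 \<Longrightarrow> l2_norm (S f) \<le> C * l2_norm f"
    using assms(1) by (rule bounded_op_bound) blast
  obtain D where D: "\<And>f. f \<in> l2 \<Longrightarrow> l2_norm (T f) \<le> D * l2_norm f"
    using assms(2) by (rule bounded_op_bound) blast
  show ?thesis
  proof (rule bounded_opI[where C="C * D"])
    fix f :: "'c vec" assume f: "f \<in> l2"
    show "l2_norm ((S \<circ> T) f) \<le> C * D * l2_norm f"
      using C(2)[of "T f"] mult_left_mono[OF D[OF f] C(1)] assms f by (simp add: mult.assoc)
  qed (use assms in \<open>auto simp: bounded_op_add bounded_op_scale bounded_op_outside\<close>)
qed

lemma comp_id_op [simp]: "bounded_op T \<Longrightarrow> T \<circ> id_op = T" "bounded_op T \<Longrightarrow> id_op \<circ> T = T"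
  by (auto intro!: bounded_op_eqI)

lemma bounded_op_trunc_expand:
  assumes "bounded_op T" "finite F"
  shows "T (trunc F f) = (\<Sum>x\<in>F. vscale (f x) (T (delta x)))"
  using assms by (simp add: trunc_finite_sum bounded_op_sum bounded_op_scale)

lemma l2_inner_sum_left:
  assumes "\<And>i. i \<in> I \<Longrightarrow> f i \<in> l2" "g \<in> l2"
  shows "l2_inner (\<Sum>i\<in>I. f i) g = (\<Sum>i\<in>I. l2_inner (f i) g)"
  using assms(1)
  by (induction I rule: infinite_finite_induct) (auto simp: assms(2) l2_inner_add_left l2_sum)

text \<open>Riesz representation with respect to the standard basis: the representing vector is
  forced to have the entries \<open>l2_inner (T (delta x)) g\<close>.\<close>

lemma adjoint_vector_exists:
  fixes T :: "('a, 'b) op"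
  assumes T: "bounded_op T" and g: "g \<in> l2"
  shows "\<exists>h. h \<in> l2 \<and> (\<forall>f\<in>l2. l2_inner (T f) g = l2_inner f h)"
proof -
  obtain C where C: "C \<ge> 0" "\<And>f. f \<in> l2 \<Longrightarrow> l2_norm (T f) \<le> C * l2_norm f"
    using T by (rule bounded_op_bound) blast
  define h where "h = (\<lambda>x. l2_inner (T (delta x)) g)"
  have fin: "l2_inner (T (trunc F f)) g = (\<Sum>x\<in>F. cnj (f x) * h x)" if "finite F" for F f
    using that T g
    by (simp add: bounded_op_trunc_expand l2_inner_sum_left l2_inner_scale_left h_def)
  have bound: "cmod (l2_inner (T f) g) \<le> C * l2_norm f * l2_norm g" if "f \<in> l2" for f
    using l2_Cauchy_Schwarz[of "T f" g] mult_right_mono[OF C(2)[OF that], of "l2_norm g"] T g that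
    by fastforce
  \<comment> \<open>The bound is tested on \<open>trunc F h\<close> itself, giving
    \<open>n * n \<le> (C * l2_norm g) * n\<close>. Cancelling \<open>n\<close> bounds the partial
    sums uniformly in \<open>F\<close>.\<close>
  have "sum (\<lambda>x. (cmod (h x))\<^sup>2) F \<le> (C * l2_norm g)\<^sup>2" if F: "finite F" for F
  proof -
    define s where "s = sum (\<lambda>x. (cmod (h x))\<^sup>2) F"
    define n where "n = l2_norm (trunc F h)"
    have s: "s = n\<^sup>2"
      using F by (simp add: n_def s_def l2_norm_trunc_square)
    have "l2_inner (T (trunc F h)) g = of_real s"
      using F complex_norm_square by (simp add: fin s_def mult.commute)
    hence "cmod (of_real s) \<le> C * n * l2_norm g"
      using bound[of "trunc F h"] F by (simp add: n_def)
    hence "n * n \<le> (C * l2_norm g) * n"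
      by (simp add: s power2_eq_square mult_ac norm_mult)
    moreover have "n \<ge> 0" by (simp add: n_def)
    ultimately have "n \<le> C * l2_norm g"
      using C(1) by (cases "n = 0") auto
    thus ?thesis using \<open>n \<ge> 0\<close> unfolding s_def[symmetric] s by (intro power_mono)
  qed
  hence h: "h \<in> l2"
    unfolding l2_def by (auto intro!: nonneg_bdd_above_summable_on bdd_aboveI2)
  moreover have "l2_inner (T f) g = l2_inner f h" if f: "f \<in> l2" for f
  proof -
    have eq: "l2_inner (T (trunc F f)) g = l2_inner (trunc F f) h" if "finite F" for F
    proof -
      have "l2_inner (trunc F f) h = (\<Sum>\<^sub>\<infinity>x\<in>F. cnj (f x) * h x)"
        unfolding l2_inner_def by (rule infsum_cong_neutral) (auto simp: trunc_def)
      thus ?thesis using that by (simp add: fin)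
    qed
    \<comment> \<open>The two sides agree on finite truncations of \<open>f\<close>; their
      disagreement \<open>d\<close> at \<open>f\<close> is squeezed to 0 by the truncation
      error.\<close>
    define d where "d = cmod (l2_inner (T f) g - l2_inner f h)"
    have "d \<le> l2_norm (f - trunc F f) * (C * l2_norm g + l2_norm h)" if "finite F" for F
    proof -
      have "d = cmod (l2_inner (T (f - trunc F f)) g - l2_inner (f - trunc F f) h)"
        using eq[OF that] f g h T by (simp add: d_def bounded_op_diff l2_inner_simps)
      also have "\<dots> \<le> C * l2_norm (f - trunc F f) * l2_norm g + l2_norm (f - trunc F f) * l2_norm h"
        by (rule order_trans[OF norm_triangle_ineq4 add_mono])
           (use f h bound in \<open>auto intro: l2_Cauchy_Schwarz\<close>)
      finally show ?thesis by (simp add: algebra_simps)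
    qed
    hence "\<forall>\<^sub>F F in finite_subsets_at_top UNIV.
        d \<le> l2_norm (f - trunc F f) * (C * l2_norm g + l2_norm h)"
      by (intro eventually_finite_subsets_at_top_weakI)
    moreover have "((\<lambda>F. l2_norm (f - trunc F f) * (C * l2_norm g + l2_norm h)) \<longlongrightarrow>
        0 * (C * l2_norm g + l2_norm h)) (finite_subsets_at_top UNIV)"
      using f by (intro tendsto_intros trunc_tendsto)
    ultimately have "d \<le> 0"
      using tendsto_lowerbound[of _ _ "finite_subsets_at_top UNIV" d] by fastforce
    thus ?thesis by (simp add: d_def)
  qed
  ultimately show ?thesis by blast
qed

lemma adj_eqI:
  assumes "g \<in> l2" "h \<in> l2" "\<And>f. f \<in> l2 \<Longrightarrow> l2_inner (T f) g = l2_inner f h"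
  shows "adj T g = h"
proof -
  have "(THE h. h \<in> l2 \<and> (\<forall>f\<in>l2. l2_inner (T f) g = l2_inner f h)) = h"
    by (rule the_equality) (use assms in \<open>auto intro!: l2_eqI_inner\<close>)
  thus ?thesis using assms(1) by (simp add: adj_def)
qed

lemma
  assumes T: "bounded_op T" and g: "g \<in> l2"
  shows adj_l2 [simp]: "adj T g \<in> l2"
    and inner_adj_right: "f \<in> l2 \<Longrightarrow> l2_inner f (adj T g) = l2_inner (T f) g"
proof -
  obtain h where h: "h \<in> l2" "\<And>f. f \<in> l2 \<Longrightarrow> l2_inner (T f) g = l2_inner f h"
    using adjoint_vector_exists[OF T g] by blast
  moreover from this have "adj T g = h" using g by (intro adj_eqI)
  ultimately show "adj T g \<in> l2" "f \<in> l2 \<Longrightarrow> l2_inner f (adj T g) = l2_inner (T f) g"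
    by auto
qed

lemma inner_adj_left:
  "bounded_op T \<Longrightarrow> f \<in> l2 \<Longrightarrow> g \<in> l2 \<Longrightarrow> l2_inner (adj T g) f = l2_inner g (T f)"
  using inner_adj_right[of T g f] l2_inner_commute by metis

text \<open>The squared norm of \<open>adj T g\<close> is \<open>l2_inner (T (adj T g)) g\<close>;
  Cauchy-Schwarz leaves one factor to cancel.\<close>

lemma adj_bound:
  assumes T: "bounded_op T" and C: "C \<ge> 0" "\<And>f. f \<in> l2 \<Longrightarrow> l2_norm (T f) \<le> C * l2_norm f"
    and g: "g \<in> l2"
  shows "l2_norm (adj T g) \<le> C * l2_norm g"
proof -
  define n where "n = l2_norm (adj T g)"
  have "of_real (n * n) = l2_inner (T (adj T g)) g"
    using T g inner_adj_right[of T g "adj T g"] by (simp add: l2_inner_self n_def power2_eq_square)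
  hence "n * n = cmod (l2_inner (T (adj T g)) g)"
    by (metis abs_mult_self_eq abs_of_nonneg norm_of_real zero_le_square)
  also have "\<dots> \<le> l2_norm (T (adj T g)) * l2_norm g"
    using T g by (intro l2_Cauchy_Schwarz) auto
  also have "\<dots> \<le> C * n * l2_norm g"
    unfolding n_def using T g by (intro mult_right_mono C) auto
  finally have "n * n \<le> (C * l2_norm g) * n" by (simp add: mult_ac)
  moreover have "n \<ge> 0" by (simp add: n_def)
  ultimately have "n \<le> C * l2_norm g" using C(1) by (cases "n = 0") auto
  thus ?thesis by (simp add: n_def)
qed

lemma bounded_op_adj [simp, intro]:
  assumes T: "bounded_op T" shows "bounded_op (adj T)"
proof -
  obtain C where C: "C \<ge> 0" "\<And>f. f \<in> l2 \<Longrightarrow> l2_norm (T f) \<le> C * l2_norm f"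
    using T by (rule bounded_op_bound) blast
  show ?thesis
  proof (rule bounded_opI[where C=C])
    show "adj T (f + g) = adj T f + adj T g" if "f \<in> l2" "g \<in> l2" for f g
      by (rule adj_eqI) (use T that in \<open>auto simp: l2_inner_simps inner_adj_right\<close>)
    show "adj T (vscale c f) = vscale c (adj T f)" if "f \<in> l2" for c f
      by (rule adj_eqI) (use T that in \<open>auto simp: l2_inner_simps inner_adj_right\<close>)
    show "l2_norm (adj T f) \<le> C * l2_norm f" if "f \<in> l2" for f
      using adj_bound[OF T C that] .
    show "adj T f = 0" if "f \<notin> l2" for f
      using that by (simp add: adj_def)
  qed (use T in auto)
qed

lemma adj_unique:
  assumes "bounded_op T" "bounded_op S"
    and "\<And>f g. f \<in> l2 \<Longrightarrow> g \<in> l2 \<Longrightarrow> l2_inner (T f) g = l2_inner f (S g)"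
  shows "adj T = S"
  by (rule bounded_op_eqI) (use assms in \<open>auto intro!: adj_eqI\<close>)

lemma adj_id_op [simp]: "adj id_op = id_op"
  by (rule adj_unique) auto

lemma adj_minus: "bounded_op S \<Longrightarrow> bounded_op T \<Longrightarrow> adj (S - T) = adj S - adj T"
  by (rule adj_unique) (auto simp: l2_inner_simps inner_adj_right)

text \<open>Polarisation: the vectors \<open>f + g\<close> and \<open>f + vscale \<i> g\<close>
  yield the sum and the difference of the two mixed terms. Complex scalars are essential, since a
  real rotation by a right angle has vanishing quadratic form.\<close>

lemma op_eq_0_if_quadratic_form_0:
  fixes S :: "('a, 'a) op"
  assumes S: "bounded_op S" and 0: "\<And>f. f \<in> l2 \<Longrightarrow> l2_inner f (S f) = 0"
  shows "S = 0"
proof (rule bounded_op_eqI)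
  fix g :: "'a vec" assume g: "g \<in> l2"
  have "l2_inner f (S g) = 0" if f: "f \<in> l2" for f
  proof -
    have "l2_inner f (S g) + l2_inner g (S f) = 0"
      using 0[of "f + g"] 0[OF f] 0[OF g] f g S by (simp add: bounded_op_add l2_inner_simps add.commute)
    moreover have "\<i> * l2_inner f (S g) - \<i> * l2_inner g (S f) = 0"
      using 0[of "f + vscale \<i> g"] 0[OF f] 0[OF g] f g S
      by (simp add: bounded_op_add bounded_op_scale l2_inner_simps)
    ultimately show ?thesis by (simp add: add_eq_0_iff)
  qed
  hence "S g = 0" by (intro l2_eqI_inner) auto
  thus "S g = 0 g" by simp
qed (use S in auto)

text \<open>A real quadratic form takes the same values for \<open>a\<close> and
  \<open>adj a\<close>, so polarisation applies to their difference.\<close>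

lemma positive_op_adj:
  assumes "positive_op a" shows "adj a = a"
proof -
  have a: "bounded_op a" using assms by (simp add: positive_op_def)
  have "adj a - a = 0"
  proof (rule op_eq_0_if_quadratic_form_0)
    fix f :: "'a vec" assume f: "f \<in> l2"
    have "l2_inner (a f) f = l2_inner f (a f)"
      using assms f unfolding positive_op_def
      by (subst l2_inner_commute) (auto simp: complex_eq_iff)
    thus "l2_inner f ((adj a - a) f) = 0"
      using a f by (simp add: l2_inner_simps inner_adj_right)
  qed (use a in auto)
  thus ?thesis by simp
qed

text \<open>Evaluated at \<open>g - vscale (of_real t) (a g)\<close>, the form has no constant term
  and the linear term \<open>- 2 * n * t\<close>, where \<open>n\<close> is the squared norm of
  \<open>a g\<close>. For small positive \<open>t\<close> it would be negative. This replaces an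
  argument with the square root of \<open>a\<close>.\<close>

lemma positive_op_kernel:
  assumes a: "positive_op a" and g: "g \<in> l2" "l2_inner g (a g) = 0"
  shows "a g = 0"
proof (rule ccontr)
  assume "a g \<noteq> 0"
  have b: "bounded_op a" using a by (simp add: positive_op_def)
  define h where "h = a g"
  define n where "n = (l2_norm h)\<^sup>2"
  have h: "h \<in> l2" and n: "n > 0"
    using g b \<open>a g \<noteq> 0\<close> by (auto simp: h_def n_def l2_norm_pos_iff)
  define m where "m = Re (l2_inner h (a h))"
  have m: "m \<ge> 0" using a h by (simp add: positive_op_def m_def)
  have hh: "l2_inner h h = of_real n" by (simp add: n_def l2_inner_self)
  have gah: "l2_inner g (a h) = of_real n"
    using inner_adj_left[OF b h g(1)] positive_op_adj[OF a] hh by (simp add: h_def)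
  have ineq: "0 \<le> t * (t * m - 2 * n)" for t :: real
  proof -
    let ?f = "g - vscale (of_real t) h"
    have "0 \<le> Re (l2_inner ?f (a ?f))"
      using a g h by (simp add: positive_op_def)
    \<comment> \<open>The last summand has real part 0 because \<open>m\<close> is the real part of
      \<open>l2_inner h (a h)\<close>; it disappears when \<open>Re\<close> is taken.\<close>
    also have "l2_inner ?f (a ?f) = of_real (t * (t * m - 2 * n)) + of_real (t * t) * (l2_inner h (a h) - of_real m)"
      using g h b gah hh
      by (simp add: bounded_op_diff bounded_op_scale l2_inner_simps h_def[symmetric] algebra_simps)
    finally show ?thesis by (simp add: m_def)
  qed
  \<comment> \<open>The value \<open>t = n / (m + 1)\<close> makes \<open>t * m \<le> n\<close>, and
    the 1 keeps the denominator positive when \<open>m = 0\<close>.\<close>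
  have "n / (m + 1) * (n / (m + 1) * m - 2 * n) < 0"
  proof (rule mult_pos_neg)
    have "n / (m + 1) * m \<le> n" using n m by (simp add: field_simps)
    thus "n / (m + 1) * m - 2 * n < 0" using n by linarith
  qed (use n m in auto)
  with ineq show False by (metis not_less)
qed

text \<open>Preservation of norms controls only the quadratic form of
  \<open>adj u \<circ> u - id_op\<close>, and polarisation shows that this is enough.\<close>

lemma isometry_adj_comp:
  assumes "l2_isometry u" shows "adj u \<circ> u = id_op"
proof -
  have u: "bounded_op u" using assms by (simp add: l2_isometry_def)
  have "(adj u \<circ> u) - id_op = 0"
  proof (rule op_eq_0_if_quadratic_form_0)
    fix f :: "'a vec" assume f: "f \<in> l2"
    have "l2_norm (u f) = l2_norm f" using assms f by (simp add: l2_isometry_def)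
    thus "l2_inner f (((adj u \<circ> u) - id_op) f) = 0"
      using u f by (simp add: l2_inner_simps inner_adj_right l2_inner_self)
  qed (use u in auto)
  thus ?thesis by simp
qed

subsection \<open>The operator norm\<close>

lemma op_norm_le:
  assumes "\<And>f. f \<in> l2 \<Longrightarrow> l2_norm f \<le> 1 \<Longrightarrow> l2_norm (T f) \<le> C"
  shows "op_norm T \<le> C"
  unfolding op_norm_def
proof (rule cSup_least)
  show "(\<lambda>f. l2_norm (T f)) ` {f \<in> l2. l2_norm f \<le> 1} \<noteq> {}"
    using l2_zero by force
qed (use assms in auto)

lemma op_norm_bound:
  assumes T: "bounded_op T" and f: "f \<in> l2"
  shows "l2_norm (T f) \<le> op_norm T * l2_norm f"
proof (cases "f = 0")
  case False
  obtain C where C: "C \<ge> 0" "\<And>f. f \<in> l2 \<Longrightarrow> l2_norm (T f) \<le> C * l2_norm f"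
    using T by (rule bounded_op_bound) blast
  define n where "n = l2_norm f"
  have n: "n > 0" using False f by (simp add: n_def l2_norm_pos_iff)
  define g where "g = vscale (of_real (1 / n)) f"
  have "l2_norm (T g) \<le> op_norm T"
    unfolding op_norm_def
  proof (rule cSup_upper)
    show "bdd_above ((\<lambda>f. l2_norm (T f)) ` {f \<in> l2. l2_norm f \<le> 1})"
    proof (rule bdd_aboveI2)
      fix f :: "'a vec" assume "f \<in> {f \<in> l2. l2_norm f \<le> 1}"
      thus "l2_norm (T f) \<le> C" using C(2)[of f] mult_left_mono[of "l2_norm f" 1 C] C(1) by auto
    qed
    show "l2_norm (T g) \<in> (\<lambda>f. l2_norm (T f)) ` {f \<in> l2. l2_norm f \<le> 1}"
      using n f by (auto simp: g_def n_def[symmetric] norm_divide intro!: imageI)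
  qed
  moreover have "T g = vscale (of_real (1 / n)) (T f)"
    using T f by (simp only: g_def bounded_op_scale)
  ultimately show ?thesis using n by (simp add: norm_divide field_simps n_def)
qed (use T in simp)

lemma op_norm_nonneg [simp]:
  assumes "bounded_op T" shows "0 \<le> op_norm T"
  using order_trans[OF l2_norm_nonneg op_norm_bound[OF assms delta_l2]] by simp

lemma op_norm_leI:
  assumes "C \<ge> 0" "\<And>f. f \<in> l2 \<Longrightarrow> l2_norm (T f) \<le> C * l2_norm f"
  shows "op_norm T \<le> C"
proof (rule op_norm_le)
  fix f :: "'a vec" assume "f \<in> l2" "l2_norm f \<le> 1"
  thus "l2_norm (T f) \<le> C"
    using assms(2)[of f] mult_left_mono[of "l2_norm f" 1 C] assms(1) by auto
qed

lemma op_norm_zero [simp]: "op_norm 0 = 0"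
  by (rule antisym[OF op_norm_leI op_norm_nonneg]) auto

lemma op_norm_triangle:
  assumes "bounded_op S" "bounded_op T"
  shows "op_norm (S + T) \<le> op_norm S + op_norm T"
proof (rule op_norm_leI)
  fix f :: "'a vec" assume f: "f \<in> l2"
  show "l2_norm ((S + T) f) \<le> (op_norm S + op_norm T) * l2_norm f"
    using l2_norm_triangle[of "S f" "T f"] op_norm_bound[OF assms(1) f]
      op_norm_bound[OF assms(2) f] assms f by (simp add: distrib_right)
qed (use assms in auto)

lemma op_norm_scale_le:
  assumes "bounded_op T" shows "op_norm (op_scale c T) \<le> cmod c * op_norm T"
proof (rule op_norm_leI)
  fix f :: "'a vec" assume f: "f \<in> l2"
  show "l2_norm (op_scale c T f) \<le> cmod c * op_norm T * l2_norm f"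
    using mult_left_mono[OF op_norm_bound[OF assms f], of "cmod c"] by (simp add: mult.assoc)
qed (use assms in auto)

lemma op_norm_comp_le:
  assumes "bounded_op S" "bounded_op T"
  shows "op_norm (S \<circ> T) \<le> op_norm S * op_norm T"
proof (rule op_norm_leI)
  fix f :: "'c vec" assume f: "f \<in> l2"
  show "l2_norm ((S \<circ> T) f) \<le> op_norm S * op_norm T * l2_norm f"
    using op_norm_bound[OF assms(1), of "T f"] assms f
      mult_left_mono[OF op_norm_bound[OF assms(2) f], of "op_norm S"] by (simp add: mult.assoc)
qed (use assms in auto)

lemma op_norm_adj_le: "bounded_op T \<Longrightarrow> op_norm (adj T) \<le> op_norm T"
  by (intro op_norm_leI adj_bound op_norm_bound) auto

lemma op_norm_triangle_diff:
  assumes "bounded_op R" "bounded_op S" "bounded_op T"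
  shows "op_norm (R - T) \<le> op_norm (R - S) + op_norm (S - T)"
  using op_norm_triangle[of "R - S" "S - T"] assms by simp

subsection \<open>Rank one operators and truncations\<close>

text \<open>The ket-bra of \<open>\<xi>\<close> and \<open>\<zeta>\<close>: linear in
  \<open>\<xi>\<close>, conjugate linear in \<open>\<zeta>\<close>. Linearity in
  \<open>\<xi>\<close> is what later makes the constructed isometry linear.\<close>

definition rank1 :: "'b vec \<Rightarrow> 'a vec \<Rightarrow> ('a, 'b) op" where
  "rank1 \<xi> \<zeta> = (\<lambda>f. if f \<in> l2 then vscale (l2_inner \<zeta> f) \<xi> else 0)"

lemma rank1_apply [simp]: "f \<in> l2 \<Longrightarrow> rank1 \<xi> \<zeta> f = vscale (l2_inner \<zeta> f) \<xi>"
  by (simp add: rank1_def)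

lemma rank1_norm_le:
  assumes "\<zeta> \<in> l2" "f \<in> l2"
  shows "l2_norm (rank1 \<xi> \<zeta> f) \<le> l2_norm \<xi> * l2_norm \<zeta> * l2_norm f"
  using mult_right_mono[OF l2_Cauchy_Schwarz[OF assms], of "l2_norm \<xi>"] assms
  by (simp add: mult_ac)

lemma bounded_op_rank1 [simp, intro]:
  assumes "\<xi> \<in> l2" "\<zeta> \<in> l2" shows "bounded_op (rank1 \<xi> \<zeta>)"
proof (rule bounded_opI[where C="l2_norm \<xi> * l2_norm \<zeta>"])
  show "rank1 \<xi> \<zeta> f = 0" if "f \<notin> l2" for f
    using that by (simp add: rank1_def)
  show "l2_norm (rank1 \<xi> \<zeta> f) \<le> l2_norm \<xi> * l2_norm \<zeta> * l2_norm f" if "f \<in> l2" for f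
    using assms(2) that by (rule rank1_norm_le)
qed (use assms in \<open>auto simp: l2_inner_simps vs.scale_left_distrib\<close>)

lemma op_norm_rank1_le: "\<zeta> \<in> l2 \<Longrightarrow> op_norm (rank1 \<xi> \<zeta>) \<le> l2_norm \<xi> * l2_norm \<zeta>"
  by (intro op_norm_leI rank1_norm_le) auto

lemma adj_rank1 [simp]: "\<xi> \<in> l2 \<Longrightarrow> \<zeta> \<in> l2 \<Longrightarrow> adj (rank1 \<xi> \<zeta>) = rank1 \<zeta> \<xi>"
  by (rule adj_unique)
     (auto simp: l2_inner_simps mult.commute l2_inner_commute[of _ \<zeta>])

lemma comp_rank1: "bounded_op T \<Longrightarrow> \<xi> \<in> l2 \<Longrightarrow> \<zeta> \<in> l2 \<Longrightarrow> T \<circ> rank1 \<xi> \<zeta> = rank1 (T \<xi>) \<zeta>"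
  by (rule bounded_op_eqI) (auto simp: bounded_op_scale)

lemma rank1_comp:
  "bounded_op T \<Longrightarrow> \<xi> \<in> l2 \<Longrightarrow> \<zeta> \<in> l2 \<Longrightarrow> rank1 \<xi> \<zeta> \<circ> T = rank1 \<xi> (adj T \<zeta>)"
  by (rule bounded_op_eqI) (auto simp: inner_adj_left)

lemma rank1_add_left: "rank1 (\<xi> + \<xi>') \<zeta> = rank1 \<xi> \<zeta> + rank1 \<xi>' \<zeta>"
  by (rule ext) (simp add: rank1_def vs.scale_right_distrib)

lemma rank1_scale_left: "rank1 (vscale c \<xi>) \<zeta> = op_scale c (rank1 \<xi> \<zeta>)"
  by (rule ext) (simp add: rank1_def mult.commute)

lemma rank1_diff_left: "rank1 (\<xi> - \<xi>') \<zeta> = rank1 \<xi> \<zeta> - rank1 \<xi>' \<zeta>"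
  by (rule ext) (simp add: rank1_def vs.scale_right_diff_distrib)

lemma rank1_diff_right:
  "\<zeta> \<in> l2 \<Longrightarrow> \<zeta>' \<in> l2 \<Longrightarrow> rank1 \<xi> (\<zeta> - \<zeta>') = rank1 \<xi> \<zeta> - rank1 \<xi> \<zeta>'"
  by (rule ext) (simp add: rank1_def l2_inner_simps vs.scale_left_diff_distrib)

lemma delta_apply: "delta x y = (if y = x then 1 else 0)"
  by (simp add: delta_def)

text \<open>Multiplication by the indicator function of \<open>F\<close>; along the finite sets
  these projections converge strongly to the identity.\<close>

definition trunc_op :: "'a set \<Rightarrow> ('a, 'a) op" where
  "trunc_op F = (\<lambda>f. if f \<in> l2 then trunc F f else 0)"

lemma trunc_op_apply [simp]: "f \<in> l2 \<Longrightarrow> trunc_op F f = trunc F f"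
  by (simp add: trunc_op_def)

lemma bounded_op_trunc_op [simp, intro]: "bounded_op (trunc_op F)"
proof (rule bounded_opI[where C=1])
  show "trunc_op F f = 0" if "f \<notin> l2" for f
    using that by (simp add: trunc_op_def)
  show "trunc_op F (f + g) = trunc_op F f + trunc_op F g" if "f \<in> l2" "g \<in> l2" for f g
    using that by (auto simp: fun_eq_iff trunc_def plus_fun_apply)
  show "trunc_op F (vscale c f) = vscale c (trunc_op F f)" if "f \<in> l2" for c f
    using that by (auto simp: fun_eq_iff trunc_def vscale_apply)
qed (auto simp: l2_norm_trunc_le)

lemma op_norm_trunc_op_le: "op_norm (trunc_op F) \<le> 1"
  by (rule op_norm_leI) (auto simp: l2_norm_trunc_le)

lemma trunc_op_empty: "trunc_op {} = 0"
  by (auto simp: fun_eq_iff trunc_op_def trunc_def zero_fun_apply)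

text \<open>Allows induction over a finite \<open>F\<close>, presenting \<open>trunc_op F\<close> as
  a sum of rank one projections.\<close>

lemma trunc_op_insert:
  "x \<notin> F \<Longrightarrow> trunc_op (insert x F) = rank1 (delta x) (delta x) + trunc_op F"
proof (rule bounded_op_eqI)
  fix f :: "'a vec" assume "x \<notin> F" "f \<in> l2"
  thus "trunc_op (insert x F) f = (rank1 (delta x) (delta x) + trunc_op F) f"
    by (auto simp: fun_eq_iff trunc_def plus_fun_apply vscale_apply delta_apply)
qed auto

subsection \<open>The uniform Roe algebra\<close>

lemma roe_bounded [simp]: "a \<in> roe_alg \<Longrightarrow> bounded_op a"
  by (simp add: roe_alg_def)

lemma roe_approx:
  assumes "a \<in> roe_alg" "\<epsilon> > 0"
  obtains s where "bounded_op s" "finite_prop s" "op_norm (a - s) < \<epsilon>"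
  using assms unfolding roe_alg_def op_sub_eq_minus by blast

text \<open>A norm closure is closed, by halving \<open>\<epsilon>\<close>. The membership proofs
  below need only approximants from the algebra itself.\<close>

lemma roe_limitI:
  assumes T: "bounded_op T" and approx: "\<And>\<epsilon>. \<epsilon> > 0 \<Longrightarrow> \<exists>S\<in>roe_alg. op_norm (T - S) < \<epsilon>"
  shows "T \<in> roe_alg"
  unfolding roe_alg_def
proof (intro CollectI conjI allI impI)
  fix \<epsilon> :: real assume "\<epsilon> > 0"
  hence e: "\<epsilon> / 2 > 0" by simp
  obtain S where S: "S \<in> roe_alg" "op_norm (T - S) < \<epsilon> / 2" using approx[OF e] by blast
  obtain R where R: "bounded_op R" "finite_prop R" "op_norm (S - R) < \<epsilon> / 2"
    using roe_approx[OF S(1) e] .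
  have "op_norm (T - R) < \<epsilon>"
    using op_norm_triangle_diff[of T S R] T S R by simp
  thus "\<exists>S. bounded_op S \<and> finite_prop S \<and> op_norm (op_sub T S) < \<epsilon>"
    using R by auto
qed (rule T)

lemma roe_finite_prop: "bounded_op T \<Longrightarrow> finite_prop T \<Longrightarrow> T \<in> roe_alg"
  unfolding roe_alg_def by (intro CollectI conjI allI impI exI[of _ T]) simp_all

lemma roe_zero [simp, intro]: "0 \<in> roe_alg"
  by (rule roe_finite_prop) (auto simp: finite_prop_def zero_fun_apply)

lemma roe_trunc_op [simp, intro]: "trunc_op F \<in> roe_alg"
  by (rule roe_finite_prop)
     (auto simp: finite_prop_def trunc_def delta_apply intro!: exI[of _ 0])

lemma roe_id [simp, intro]: "id_op \<in> roe_alg"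
  by (rule roe_finite_prop) (auto simp: finite_prop_def delta_apply intro!: exI[of _ 0])

lemma finite_prop_plus:
  assumes "finite_prop S" "finite_prop T" shows "finite_prop (S + T)"
proof -
  obtain r s where "\<And>x y. dist x y > r \<Longrightarrow> S (delta x) y = 0"
      "\<And>x y. dist x y > s \<Longrightarrow> T (delta x) y = 0"
    using assms unfolding finite_prop_def by blast
  thus ?thesis
    by (auto simp: finite_prop_def plus_fun_apply intro!: exI[of _ "max r s"])
qed

lemma finite_prop_scale: "finite_prop T \<Longrightarrow> finite_prop (op_scale c T)"
  by (auto simp: finite_prop_def vscale_apply)

lemma adj_delta_entry: "bounded_op T \<Longrightarrow> adj T (delta x) y = cnj (T (delta y) x)"
  using inner_adj_right[of T "delta x" "delta y"] l2_inner_commute[of "T (delta y)" "delta x"]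
  by simp

lemma finite_prop_adj:
  assumes T: "bounded_op T" and "finite_prop T" shows "finite_prop (adj T)"
proof -
  obtain r where "\<And>x y. dist x y > r \<Longrightarrow> T (delta x) y = 0"
    using assms unfolding finite_prop_def by blast
  thus ?thesis
    by (auto simp: finite_prop_def adj_delta_entry[OF T] dist_commute intro!: exI[of _ r])
qed

lemma finite_prop_comp:
  assumes S: "bounded_op S" "finite_prop S" and T: "bounded_op T" "finite_prop T"
  shows "finite_prop (S \<circ> T)"
proof -
  obtain r s where r: "\<And>x y. dist x y > r \<Longrightarrow> S (delta x) y = 0"
      and s: "\<And>x y. dist x y > s \<Longrightarrow> T (delta x) y = 0"
    using assms unfolding finite_prop_def by blast
  have "(S \<circ> T) (delta x) y = 0" if d: "dist x y > r + s" for x y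
  proof -
    \<comment> \<open>Moving \<open>S\<close> across the inner product gives the matrix product
      formula at once, without exchanging \<open>S\<close> with an infinite sum.\<close>
    have "(S \<circ> T) (delta x) y = l2_inner (adj S (delta y)) (T (delta x))"
      using S T by (simp add: inner_adj_left)
    also have "\<dots> = (\<Sum>\<^sub>\<infinity>z. S (delta z) y * T (delta x) z)"
      using S by (simp add: l2_inner_def adj_delta_entry)
    also have "\<dots> = 0"
    proof (rule infsum_0)
      fix z
      have "dist z y > r \<or> dist x z > s"
        using d dist_triangle[of x y z] by linarith
      thus "S (delta z) y * T (delta x) z = 0" using r s by auto
    qed
    finally show ?thesis .
  qed
  thus ?thesis unfolding finite_prop_def by blast
qed

lemma roe_plus [simp, intro]:
  assumes "a \<in> roe_alg" "b \<in> roe_alg" shows "a + b \<in> roe_alg"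
proof (rule roe_limitI)
  fix \<epsilon> :: real assume "\<epsilon> > 0"
  hence e: "\<epsilon> / 2 > 0" by simp
  obtain s where s: "bounded_op s" "finite_prop s" "op_norm (a - s) < \<epsilon> / 2"
    using roe_approx[OF assms(1) e] .
  obtain t where t: "bounded_op t" "finite_prop t" "op_norm (b - t) < \<epsilon> / 2"
    using roe_approx[OF assms(2) e] .
  have "op_norm ((a - s) + (b - t)) < \<epsilon>"
    using op_norm_triangle[of "a - s" "b - t"] assms s t by simp
  hence "op_norm (a + b - (s + t)) < \<epsilon>" by (simp add: algebra_simps)
  moreover have "s + t \<in> roe_alg" using s t by (intro roe_finite_prop finite_prop_plus) auto
  ultimately show "\<exists>S\<in>roe_alg. op_norm (a + b - S) < \<epsilon>" by blast
qed (use assms in auto)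

lemma roe_scale [simp, intro]:
  assumes "a \<in> roe_alg" shows "op_scale c a \<in> roe_alg"
proof (rule roe_limitI)
  fix \<epsilon> :: real assume "\<epsilon> > 0"
  \<comment> \<open>The added 1 keeps the divisor of \<open>\<epsilon>\<close> positive when
    \<open>c = 0\<close>; the same device recurs below with operator norms.\<close>
  define k where "k = cmod c + 1"
  have k: "k > 0" by (simp add: k_def add_nonneg_pos)
  obtain s where s: "bounded_op s" "finite_prop s" "op_norm (a - s) < \<epsilon> / k"
    using roe_approx[OF assms, of "\<epsilon> / k"] k \<open>\<epsilon> > 0\<close> by auto
  have "op_scale c a - op_scale c s = op_scale c (a - s)"
    by (rule ext) (simp add: vs.scale_right_diff_distrib)
  hence "op_norm (op_scale c a - op_scale c s) \<le> cmod c * op_norm (a - s)"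
    using assms s by (simp add: op_norm_scale_le)
  also have "\<dots> \<le> k * op_norm (a - s)"
    using assms s by (simp add: k_def mult_right_mono)
  also have "\<dots> < \<epsilon>" using s k by (simp add: field_simps)
  finally have "op_norm (op_scale c a - op_scale c s) < \<epsilon>" .
  moreover have "op_scale c s \<in> roe_alg" using s by (intro roe_finite_prop finite_prop_scale) auto
  ultimately show "\<exists>S\<in>roe_alg. op_norm (op_scale c a - S) < \<epsilon>" by blast
qed (use assms in auto)

lemma roe_adj [simp, intro]:
  assumes "a \<in> roe_alg" shows "adj a \<in> roe_alg"
proof (rule roe_limitI)
  fix \<epsilon> :: real assume "\<epsilon> > 0"
  then obtain s where s: "bounded_op s" "finite_prop s" "op_norm (a - s) < \<epsilon>"
    using roe_approx[OF assms] by blast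
  have "op_norm (adj a - adj s) < \<epsilon>"
    using op_norm_adj_le[of "a - s"] assms s by (simp add: adj_minus)
  moreover have "adj s \<in> roe_alg" using s by (intro roe_finite_prop finite_prop_adj) auto
  ultimately show "\<exists>S\<in>roe_alg. op_norm (adj a - S) < \<epsilon>" by blast
qed (use assms in auto)

text \<open>Products are approximated one factor at a time. With \<open>t\<close> fixed, the error
  in \<open>a\<close> is multiplied by a constant, whereas replacing both factors at once would
  require a bound on the norms of the approximants.\<close>

lemma roe_comp_finite_prop:
  assumes "a \<in> roe_alg" and t: "bounded_op t" "finite_prop t" shows "a \<circ> t \<in> roe_alg"
proof (rule roe_limitI)
  fix \<epsilon> :: real assume "\<epsilon> > 0"
  define k where "k = op_norm t + 1"
  have k: "k > 0" using op_norm_nonneg[OF t(1)] by (simp add: k_def)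
  obtain s where s: "bounded_op s" "finite_prop s" "op_norm (a - s) < \<epsilon> / k"
    using roe_approx[OF assms(1), of "\<epsilon> / k"] k \<open>\<epsilon> > 0\<close> by auto
  have "(a \<circ> t) - (s \<circ> t) = (a - s) \<circ> t" by (rule ext) simp
  hence "op_norm ((a \<circ> t) - (s \<circ> t)) \<le> op_norm (a - s) * op_norm t"
    using assms s by (simp add: op_norm_comp_le)
  also have "\<dots> \<le> op_norm (a - s) * k"
    using assms s by (intro mult_left_mono) (auto simp: k_def)
  also have "\<dots> < \<epsilon>" using s k by (simp add: field_simps)
  finally have "op_norm ((a \<circ> t) - (s \<circ> t)) < \<epsilon>" .
  moreover have "s \<circ> t \<in> roe_alg" using s t by (intro roe_finite_prop finite_prop_comp) auto
  ultimately show "\<exists>S\<in>roe_alg. op_norm ((a \<circ> t) - S) < \<epsilon>" by blast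
qed (use assms in auto)

lemma roe_comp [simp, intro]:
  assumes "a \<in> roe_alg" "b \<in> roe_alg" shows "a \<circ> b \<in> roe_alg"
proof (rule roe_limitI)
  fix \<epsilon> :: real assume "\<epsilon> > 0"
  define k where "k = op_norm a + 1"
  have a: "bounded_op a" "bounded_op b" using assms by auto
  have k: "k > 0" using op_norm_nonneg[OF a(1)] by (simp add: k_def)
  obtain t where t: "bounded_op t" "finite_prop t" "op_norm (b - t) < \<epsilon> / k"
    using roe_approx[OF assms(2), of "\<epsilon> / k"] k \<open>\<epsilon> > 0\<close> by auto
  have "(a \<circ> b) - (a \<circ> t) = a \<circ> (b - t)"
    by (rule ext) (simp add: bounded_op_diff a t)
  hence "op_norm ((a \<circ> b) - (a \<circ> t)) \<le> op_norm a * op_norm (b - t)"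
    using a t by (simp add: op_norm_comp_le)
  also have "\<dots> \<le> k * op_norm (b - t)"
    using a t by (simp add: k_def mult_right_mono)
  also have "\<dots> < \<epsilon>" using t k by (simp add: field_simps)
  finally have "op_norm ((a \<circ> b) - (a \<circ> t)) < \<epsilon>" .
  thus "\<exists>S\<in>roe_alg. op_norm ((a \<circ> b) - S) < \<epsilon>"
    using roe_comp_finite_prop[OF assms(1) t(1,2)] by blast
qed (use assms in auto)

lemma eventually_finite_subsetE:
  assumes "\<forall>\<^sub>F F in finite_subsets_at_top UNIV. P F"
  obtains F where "finite F" "P F"
  using assms by (auto simp: eventually_finite_subsets_at_top)

text \<open>Truncating both vectors to one finite set leaves a finite matrix, and the error is
  controlled by the two truncation errors.\<close>

lemma roe_rank1 [simp, intro]: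
  fixes \<xi> \<zeta> :: "'a::metric_space vec"
  assumes "\<xi> \<in> l2" "\<zeta> \<in> l2" shows "rank1 \<xi> \<zeta> \<in> roe_alg"
proof (rule roe_limitI)
  fix \<epsilon> :: real assume "\<epsilon> > 0"
  let ?fin = "finite_subsets_at_top (UNIV :: 'a set)"
  let ?B = "\<lambda>F. l2_norm (\<xi> - trunc F \<xi>) * l2_norm \<zeta> + l2_norm \<xi> * l2_norm (\<zeta> - trunc F \<zeta>)"
  have "(?B \<longlongrightarrow> 0 * l2_norm \<zeta> + l2_norm \<xi> * 0) ?fin"
    using assms by (intro tendsto_intros trunc_tendsto)
  hence "\<forall>\<^sub>F F in ?fin. ?B F < \<epsilon>"
    using \<open>\<epsilon> > 0\<close> by (intro order_tendstoD(2)) auto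
  then obtain F where F: "finite F" "?B F < \<epsilon>"
    by (rule eventually_finite_subsetE)
  let ?S = "rank1 (trunc F \<xi>) (trunc F \<zeta>)"
  have "rank1 \<xi> \<zeta> - ?S = rank1 (\<xi> - trunc F \<xi>) \<zeta> + rank1 (trunc F \<xi>) (\<zeta> - trunc F \<zeta>)"
    using assms by (simp add: rank1_diff_left rank1_diff_right)
  hence "op_norm (rank1 \<xi> \<zeta> - ?S) \<le>
      op_norm (rank1 (\<xi> - trunc F \<xi>) \<zeta>) + op_norm (rank1 (trunc F \<xi>) (\<zeta> - trunc F \<zeta>))"
    using assms by (simp add: op_norm_triangle)
  also have "\<dots> \<le> l2_norm (\<xi> - trunc F \<xi>) * l2_norm \<zeta> + l2_norm (trunc F \<xi>) * l2_norm (\<zeta> - trunc F \<zeta>)"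
    using assms by (intro add_mono op_norm_rank1_le) auto
  also have "\<dots> \<le> ?B F"
    using assms by (intro add_mono mult_right_mono l2_norm_trunc_le) auto
  also note F(2)
  finally have "op_norm (rank1 \<xi> \<zeta> - ?S) < \<epsilon>" .
  moreover have "finite_prop ?S"
    unfolding finite_prop_def
  proof (intro exI allI impI)
    \<comment> \<open>The radius is the sum of all distances between points of \<open>F\<close>, a
      crude bound on its diameter. Beyond it \<open>x\<close> and \<open>y\<close> cannot both lie
      in \<open>F\<close>.\<close>
    fix x y :: 'a assume d: "dist x y > (\<Sum>(x, y)\<in>F \<times> F. dist x y)"
    have "\<not> (x \<in> F \<and> y \<in> F)"
    proof
      assume "x \<in> F \<and> y \<in> F"
      hence "dist x y \<le> (\<Sum>(x, y)\<in>F \<times> F. dist x y)"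
        using member_le_sum[of "(x, y)" "F \<times> F" "\<lambda>(x, y). dist x y"] F(1) by auto
      with d show False by simp
    qed
    thus "?S (delta x) y = 0"
      using l2_inner_commute[of "trunc F \<zeta>" "delta x"] by (auto simp: trunc_def vscale_apply)
  qed
  ultimately show "\<exists>S\<in>roe_alg. op_norm (rank1 \<xi> \<zeta> - S) < \<epsilon>"
    using assms by (blast intro: roe_finite_prop)
qed (use assms in auto)

subsection \<open>Compact operators\<close>

lemma compact_op_bounded [simp]: "compact_op k \<Longrightarrow> bounded_op k"
  by (simp add: compact_op_def)

lemma compact_op_net:
  assumes "compact_op k" "\<epsilon> > 0"
  obtains F where "finite F" "F \<subseteq> l2"
    "\<And>f. f \<in> l2 \<Longrightarrow> l2_norm f \<le> 1 \<Longrightarrow> \<exists>g\<in>F. l2_norm (k f - g) < \<epsilon>"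
  using assms unfolding compact_op_def by (metis vsub_eq_minus)

lemma compact_opI:
  assumes "bounded_op k"
    and "\<And>\<epsilon>. \<epsilon> > 0 \<Longrightarrow> \<exists>F. finite F \<and> F \<subseteq> l2 \<and>
        (\<forall>f\<in>l2. l2_norm f \<le> 1 \<longrightarrow> (\<exists>g\<in>F. l2_norm (k f - g) < \<epsilon>))"
  shows "compact_op k"
  using assms by (simp add: compact_op_def)

lemma compact_op_zero [simp, intro]: "compact_op 0"
  by (rule compact_opI) (auto intro!: exI[of _ "{0}"])

lemma compact_op_plus [intro]:
  assumes "compact_op j" "compact_op k" shows "compact_op (j + k)"
proof (rule compact_opI)
  fix \<epsilon> :: real assume "\<epsilon> > 0"
  hence e: "\<epsilon> / 2 > 0" by simp
  obtain F where F: "finite F" "F \<subseteq> l2"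
      "\<And>f. f \<in> l2 \<Longrightarrow> l2_norm f \<le> 1 \<Longrightarrow> \<exists>g\<in>F. l2_norm (j f - g) < \<epsilon> / 2"
    using compact_op_net[OF assms(1) e] by blast
  obtain G where G: "finite G" "G \<subseteq> l2"
      "\<And>f. f \<in> l2 \<Longrightarrow> l2_norm f \<le> 1 \<Longrightarrow> \<exists>g\<in>G. l2_norm (k f - g) < \<epsilon> / 2"
    using compact_op_net[OF assms(2) e] by blast
  let ?F = "(\<lambda>(a, b). a + b) ` (F \<times> G)"
  have "\<exists>g\<in>?F. l2_norm ((j + k) f - g) < \<epsilon>" if f: "f \<in> l2" "l2_norm f \<le> 1" for f
  proof -
    obtain a b where a: "a \<in> F" "l2_norm (j f - a) < \<epsilon> / 2" and b: "b \<in> G" "l2_norm (k f - b) < \<epsilon> / 2"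
      using F(3)[OF f] G(3)[OF f] by blast
    have "j f - a \<in> l2" "k f - b \<in> l2" using assms f a b F G by auto
    hence "l2_norm ((j f - a) + (k f - b)) < \<epsilon>"
      using l2_norm_triangle[of "j f - a" "k f - b"] a b by simp
    hence "l2_norm ((j + k) f - (a + b)) < \<epsilon>" by (simp add: algebra_simps)
    thus ?thesis using a b by force
  qed
  moreover have "finite ?F" "?F \<subseteq> l2" using F G by auto
  ultimately show "\<exists>F. finite F \<and> F \<subseteq> l2 \<and>
        (\<forall>f\<in>l2. l2_norm f \<le> 1 \<longrightarrow> (\<exists>g\<in>F. l2_norm ((j + k) f - g) < \<epsilon>))" by blast
qed (use assms in auto)

lemma compact_op_comp_left [intro]:
  assumes k: "compact_op k" and T: "bounded_op T" shows "compact_op (T \<circ> k)"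
proof (rule compact_opI)
  fix \<epsilon> :: real assume "\<epsilon> > 0"
  define C where "C = op_norm T + 1"
  have C: "C > 0" using op_norm_nonneg[OF T] by (simp add: C_def)
  obtain F where F: "finite F" "F \<subseteq> l2"
      "\<And>f. f \<in> l2 \<Longrightarrow> l2_norm f \<le> 1 \<Longrightarrow> \<exists>g\<in>F. l2_norm (k f - g) < \<epsilon> / C"
    using compact_op_net[OF k, of "\<epsilon> / C"] C \<open>\<epsilon> > 0\<close> by auto
  have "\<exists>g\<in>T ` F. l2_norm ((T \<circ> k) f - g) < \<epsilon>" if f: "f \<in> l2" "l2_norm f \<le> 1" for f
  proof -
    obtain a where a: "a \<in> F" "l2_norm (k f - a) < \<epsilon> / C" using F(3)[OF f] by blast
    have al: "a \<in> l2" "k f \<in> l2" using a F k by auto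
    have "l2_norm ((T \<circ> k) f - T a) = l2_norm (T (k f - a))"
      using T al by (simp add: bounded_op_diff)
    also have "\<dots> \<le> op_norm T * l2_norm (k f - a)" using T al by (intro op_norm_bound) auto
    also have "\<dots> \<le> C * l2_norm (k f - a)" by (intro mult_right_mono) (auto simp: C_def)
    also have "\<dots> < \<epsilon>" using a C by (simp add: field_simps)
    finally show ?thesis using a by blast
  qed
  moreover have "finite (T ` F)" "T ` F \<subseteq> l2" using F T by auto
  ultimately show "\<exists>F. finite F \<and> F \<subseteq> l2 \<and>
        (\<forall>f\<in>l2. l2_norm f \<le> 1 \<longrightarrow> (\<exists>g\<in>F. l2_norm ((T \<circ> k) f - g) < \<epsilon>))" by blast
qed (use assms in auto)

lemma compact_op_scale [intro]:
  assumes "compact_op k" shows "compact_op (op_scale c k)"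
proof -
  have "op_scale c id_op \<circ> k = op_scale c k"
    by (rule ext) (use assms in simp)
  thus ?thesis using compact_op_comp_left[OF assms, of "op_scale c id_op"] by simp
qed

text \<open>Dividing \<open>T\<close> by \<open>C\<close> gives a contraction \<open>S\<close>,
  which maps the unit ball into itself, so a net for \<open>k\<close> is also a net for
  \<open>k \<circ> S\<close>. Rescaling recovers \<open>T\<close>.\<close>

lemma compact_op_comp_right [intro]:
  assumes k: "compact_op k" and T: "bounded_op T" shows "compact_op (k \<circ> T)"
proof -
  define C where "C = op_norm T + 1"
  have C: "C > 0" using op_norm_nonneg[OF T] by (simp add: C_def)
  define S where "S = op_scale (of_real (1 / C)) T"
  have S: "bounded_op S" using T by (simp add: S_def)
  have Sle: "l2_norm (S f) \<le> 1" if f: "f \<in> l2" "l2_norm f \<le> 1" for f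
  proof -
    have "l2_norm (T f) \<le> op_norm T * l2_norm f" using T f by (intro op_norm_bound)
    also have "\<dots> \<le> op_norm T * 1" using f T by (intro mult_left_mono) auto
    also have "\<dots> \<le> C" by (simp add: C_def)
    finally show ?thesis using C by (simp add: S_def norm_divide field_simps)
  qed
  have "compact_op (k \<circ> S)"
  proof (rule compact_opI)
    fix \<epsilon> :: real assume "\<epsilon> > 0"
    then obtain F where F: "finite F" "F \<subseteq> l2"
        "\<And>f. f \<in> l2 \<Longrightarrow> l2_norm f \<le> 1 \<Longrightarrow> \<exists>g\<in>F. l2_norm (k f - g) < \<epsilon>"
      using compact_op_net[OF k] by blast
    thus "\<exists>F. finite F \<and> F \<subseteq> l2 \<and>
        (\<forall>f\<in>l2. l2_norm f \<le> 1 \<longrightarrow> (\<exists>g\<in>F. l2_norm ((k \<circ> S) f - g) < \<epsilon>))"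
      using Sle S by (intro exI[of _ F]) auto
  qed (use k S in auto)
  hence "compact_op (op_scale (of_real C) (k \<circ> S))" by (rule compact_op_scale)
  moreover have "op_scale (of_real C) (k \<circ> S) = k \<circ> T"
    by (rule bounded_op_eqI) (use k S T C in \<open>auto simp: S_def bounded_op_scale\<close>)
  ultimately show ?thesis by simp
qed

text \<open>The image of the unit ball is a set of multiples of \<open>\<xi>\<close> with
  coefficients in a disc of radius \<open>l2_norm \<zeta>\<close>, and that disc is totally
  bounded.\<close>

lemma compact_op_rank1 [intro]:
  assumes "\<xi> \<in> l2" "\<zeta> \<in> l2" shows "compact_op (rank1 \<xi> \<zeta>)"
proof (rule compact_opI)
  fix \<epsilon> :: real assume "\<epsilon> > 0"
  define n where "n = l2_norm \<xi> + 1"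
  have n: "n > 0" by (simp add: n_def add_nonneg_pos)
  have "compact (cball 0 (l2_norm \<zeta>) :: complex set)" by simp
  then obtain Z :: "complex set" where Z: "finite Z" "cball 0 (l2_norm \<zeta>) \<subseteq> (\<Union>z\<in>Z. ball z (\<epsilon> / n))"
    using n \<open>\<epsilon> > 0\<close> unfolding compact_eq_totally_bounded by (meson divide_pos_pos)
  let ?F = "(\<lambda>z. vscale z \<xi>) ` Z"
  have "\<exists>g\<in>?F. l2_norm (rank1 \<xi> \<zeta> f - g) < \<epsilon>" if f: "f \<in> l2" "l2_norm f \<le> 1" for f
  proof -
    have "cmod (l2_inner \<zeta> f) \<le> l2_norm \<zeta> * l2_norm f" using assms f by (intro l2_Cauchy_Schwarz)
    also have "\<dots> \<le> l2_norm \<zeta> * 1" using f by (intro mult_left_mono) auto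
    finally obtain z where z: "z \<in> Z" "dist z (l2_inner \<zeta> f) < \<epsilon> / n" using Z by auto
    have "rank1 \<xi> \<zeta> f - vscale z \<xi> = vscale (l2_inner \<zeta> f - z) \<xi>"
      using f by (simp add: vs.scale_left_diff_distrib)
    hence "l2_norm (rank1 \<xi> \<zeta> f - vscale z \<xi>) = dist z (l2_inner \<zeta> f) * l2_norm \<xi>"
      by (simp add: dist_norm norm_minus_commute)
    also have "\<dots> \<le> dist z (l2_inner \<zeta> f) * n" by (intro mult_left_mono) (auto simp: n_def)
    also have "\<dots> < \<epsilon>" using z n by (simp add: field_simps)
    finally show ?thesis using z by blast
  qed
  moreover have "finite ?F" "?F \<subseteq> l2" using Z assms by auto
  ultimately show "\<exists>F. finite F \<and> F \<subseteq> l2 \<and>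
        (\<forall>f\<in>l2. l2_norm f \<le> 1 \<longrightarrow> (\<exists>g\<in>F. l2_norm (rank1 \<xi> \<zeta> f - g) < \<epsilon>))" by blast
qed (use assms in auto)

text \<open>Each row of the operator contributes one rank one operator,
  \<open>rank1 (delta x) (adj k (delta x))\<close>.\<close>

lemma trunc_op_comp_roe:
  assumes "bounded_op k" "finite F" shows "trunc_op F \<circ> k \<in> roe_alg"
  using assms(2)
proof (induction F rule: finite_induct)
  case empty
  have "trunc_op {} \<circ> k = 0" by (simp add: trunc_op_empty fun_eq_iff)
  thus ?case by (metis roe_zero)
next
  case (insert x F)
  have "trunc_op (insert x F) \<circ> k = (rank1 (delta x) (delta x) \<circ> k) + (trunc_op F \<circ> k)"
    using insert by (simp add: trunc_op_insert fun_eq_iff)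
  also have "\<dots> = rank1 (delta x) (adj k (delta x)) + (trunc_op F \<circ> k)"
    using assms by (simp add: rank1_comp)
  also have "\<dots> \<in> roe_alg"
    by (intro roe_plus roe_rank1 insert.IH) (use assms in auto)
  finally show ?case .
qed

text \<open>A net for the image of the unit ball is finite, so one finite \<open>F\<close> truncates
  all its points well. Hence \<open>trunc_op F \<circ> k\<close> approximates \<open>k\<close>
  uniformly on the ball, that is, in norm.\<close>

lemma compact_op_roe:
  fixes k :: "('a::metric_space, 'a) op"
  assumes k: "compact_op k" shows "k \<in> roe_alg"
proof (rule roe_limitI)
  fix \<epsilon> :: real assume "\<epsilon> > 0"
  \<comment> \<open>Three errors below \<open>e\<close> give only the weak bound
    \<open>3 * e\<close> after the supremum; the fourth quarter makes the inequality strict.\<close>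
  define e where "e = \<epsilon> / 4"
  have e: "e > 0" using \<open>\<epsilon> > 0\<close> by (simp add: e_def)
  obtain G where G: "finite G" "G \<subseteq> l2"
      "\<And>f. f \<in> l2 \<Longrightarrow> l2_norm f \<le> 1 \<Longrightarrow> \<exists>g\<in>G. l2_norm (k f - g) < e"
    using compact_op_net[OF k e] by blast
  have "\<forall>\<^sub>F F in finite_subsets_at_top (UNIV :: 'a set). \<forall>g\<in>G. l2_norm (g - trunc F g) < e"
    using G e by (intro eventually_ball_finite ballI order_tendstoD(2)[OF trunc_tendsto]) auto
  then obtain F where F: "finite F" "\<forall>g\<in>G. l2_norm (g - trunc F g) < e"
    by (rule eventually_finite_subsetE)
  have "op_norm (k - (trunc_op F \<circ> k)) \<le> 3 * e"
  proof (rule op_norm_le)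
    fix f :: "'a vec" assume f: "f \<in> l2" "l2_norm f \<le> 1"
    obtain g where g: "g \<in> G" "l2_norm (k f - g) < e" using G(3)[OF f] by blast
    have l: "k f \<in> l2" "g \<in> l2" using k f g G by auto
    have "trunc F (g - k f) = trunc F g - trunc F (k f)"
      by (auto simp: trunc_def fun_eq_iff minus_apply)
    hence "l2_norm (trunc F g - trunc F (k f)) \<le> l2_norm (g - k f)"
      using l l2_norm_trunc_le[of "g - k f" F] by simp
    moreover have "l2_norm (g - k f) < e" using g by (simp add: l2_norm_minus_commute)
    moreover have "l2_norm (g - trunc F (k f)) \<le> l2_norm (g - trunc F g) + l2_norm (trunc F g - trunc F (k f))"
      using l by (intro l2_norm_triangle_diff) auto
    moreover have "l2_norm (k f - trunc F (k f)) \<le> l2_norm (k f - g) + l2_norm (g - trunc F (k f))"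
      using l by (intro l2_norm_triangle_diff) auto
    ultimately show "l2_norm ((k - (trunc_op F \<circ> k)) f) \<le> 3 * e"
      using g bspec[OF F(2) g(1)] l by simp
  qed
  also have "\<dots> < \<epsilon>" using \<open>\<epsilon> > 0\<close> by (simp add: e_def)
  finally show "\<exists>S\<in>roe_alg. op_norm (k - S) < \<epsilon>"
    using trunc_op_comp_roe[of k F] k F(1) by (intro bexI) auto
qed (use k in auto)

text \<open>These are the test elements through which essentiality is checked and \<open>H\<close>
  is located in the range of the isometry.\<close>

lemma rank1_compacts_on:
  assumes "closed_l2_subspace H" "g \<in> H" "h \<in> H"
  shows "rank1 g h \<in> compacts_on H"
  using assms unfolding compacts_on_def closed_l2_subspace_def by auto

lemma rank1_self_eq_0D:
  assumes "w \<in> l2" "rank1 w w = 0" shows "w = 0"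
proof -
  have "rank1 w w w = 0 w" using assms(2) by (rule fun_cong)
  thus ?thesis using assms(1) by (auto simp: l2_inner_self)
qed

subsection \<open>Rank\<close>

lemma cspan_eq_span: "finite F \<Longrightarrow> cspan F = vs.span F"
  unfolding cspan_def vs.span_finite
  by (auto simp: fun_eq_iff sum_fun_apply vscale_apply)

lemma op_rank_le:
  assumes "finite F" "T ` l2 \<subseteq> vs.span F"
  shows "op_rank T \<le> enat (card F)"
proof -
  have "\<exists>F'. finite F' \<and> card F' = card F \<and> T ` l2 \<subseteq> cspan F'"
    using assms by (intro exI[of _ F]) (simp add: cspan_eq_span)
  thus ?thesis
    unfolding op_rank_def by (auto intro: Least_le)
qed

text \<open>Together with \<open>op_rank_le\<close> this is the interface to \<open>op_rank\<close>,
  hiding its least number and its infinite case.\<close>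

lemma op_rank_leD:
  assumes "op_rank T \<le> enat n"
  obtains F where "finite F" "card F \<le> n" "T ` l2 \<subseteq> vs.span F"
proof -
  let ?P = "\<lambda>n. \<exists>F. finite F \<and> card F = n \<and> T ` l2 \<subseteq> cspan F"
  have ex: "\<exists>F. finite F \<and> T ` l2 \<subseteq> cspan F"
    using assms unfolding op_rank_def by (auto split: if_splits)
  then obtain F' where "finite F'" "T ` l2 \<subseteq> cspan F'" by (elim exE conjE)
  hence "?P (card F')" by (intro exI[of _ F']) simp
  hence "?P (Least ?P)" by (rule LeastI)
  then obtain F where F: "finite F" "card F = Least ?P" "T ` l2 \<subseteq> cspan F"
    by (elim exE conjE)
  moreover have "Least ?P \<le> n" using assms ex unfolding op_rank_def by simp
  ultimately show thesis using that[of F] by (simp add: cspan_eq_span)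
qed

lemma op_rank_comp_le:
  assumes S: "bounded_op S" and T: "bounded_op T" and R: "bounded_op R"
  shows "op_rank (S \<circ> T \<circ> R) \<le> op_rank T"
proof (cases "op_rank T")
  case (enat n)
  then obtain F where F: "finite F" "card F \<le> n" "T ` l2 \<subseteq> vs.span F"
    using op_rank_leD[of T n] by auto
  \<comment> \<open>The vectors of \<open>F\<close> may lie outside \<open>l2\<close>, where
    \<open>S\<close> is not linear, so they are exchanged for a basis chosen inside the range of
    \<open>T\<close>.\<close>
  obtain B where B: "B \<subseteq> T ` l2" "vs.independent B" "T ` l2 \<subseteq> vs.span B"
    using vs.maximal_independent_subset[of "T ` l2"] by metis
  have fin: "finite B" "card B \<le> card F"
    using vs.independent_span_bound[OF F(1) B(2)] B(1) F(3) by auto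
  have Bl: "b \<in> l2" if "b \<in> B" for b using that B T by auto
  have "(S \<circ> T \<circ> R) f \<in> vs.span (S ` B)" if f: "f \<in> l2" for f
  proof -
    have "T (R f) \<in> vs.span B" using B R f by auto
    then obtain c where "T (R f) = (\<Sum>b\<in>B. vscale (c b) b)"
      using vs.span_finite[OF fin(1)] by auto
    hence "(S \<circ> T \<circ> R) f = (\<Sum>b\<in>B. S (vscale (c b) b))"
      using Bl S by (simp add: bounded_op_sum)
    also have "\<dots> = (\<Sum>b\<in>B. vscale (c b) (S b))"
      using Bl S by (intro sum.cong) (auto simp: bounded_op_scale)
    also have "\<dots> \<in> vs.span (S ` B)"
      by (intro vs.span_sum vs.span_scale vs.span_base) auto
    finally show ?thesis .
  qed
  hence "op_rank (S \<circ> T \<circ> R) \<le> enat (card (S ` B))"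
    using fin by (intro op_rank_le) auto
  also have "\<dots> \<le> op_rank T"
    using card_image_le[OF fin(1), of S] fin(2) F(2) enat by simp
  finally show ?thesis .
qed simp

lemma op_scale_zero: "op_scale 0 T = 0"
  by (rule ext) simp

subsection \<open>Embeddings of uniform Roe algebras\<close>

locale roe_emb =
  fixes \<Phi> :: "('x::metric_space, 'x) op \<Rightarrow> ('y::metric_space, 'y) op"
  assumes emb: "roe_embedding \<Phi>"
begin

abbreviation p :: "('y, 'y) op" where "p \<equiv> \<Phi> id_op"

abbreviation e :: "'x \<Rightarrow> ('x, 'x) op" where "e x \<equiv> rank1 (delta x) (delta x)"

lemma phi_roe [simp]: "a \<in> roe_alg \<Longrightarrow> \<Phi> a \<in> roe_alg"
  and phi_plus: "a \<in> roe_alg \<Longrightarrow> b \<in> roe_alg \<Longrightarrow> \<Phi> (a + b) = \<Phi> a + \<Phi> b"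
  and phi_scale: "a \<in> roe_alg \<Longrightarrow> \<Phi> (op_scale c a) = op_scale c (\<Phi> a)"
  and phi_comp: "a \<in> roe_alg \<Longrightarrow> b \<in> roe_alg \<Longrightarrow> \<Phi> (a \<circ> b) = \<Phi> a \<circ> \<Phi> b"
  and phi_adj: "a \<in> roe_alg \<Longrightarrow> \<Phi> (adj a) = adj (\<Phi> a)"
  and phi_inj: "a \<in> roe_alg \<Longrightarrow> b \<in> roe_alg \<Longrightarrow> \<Phi> a = \<Phi> b \<Longrightarrow> a = b"
  using emb unfolding roe_embedding_def op_add_eq_plus inj_on_def by metis+

lemma phi_bounded [simp]: "a \<in> roe_alg \<Longrightarrow> bounded_op (\<Phi> a)"
  by simp

lemma phi_zero [simp]: "\<Phi> 0 = 0"
  using phi_scale[of 0 0] by (simp add: op_scale_zero)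

lemma phi_eq_0D: "a \<in> roe_alg \<Longrightarrow> \<Phi> a = 0 \<Longrightarrow> a = 0"
  using phi_inj[of a 0] by simp

lemma phi_comp_apply: "a \<in> roe_alg \<Longrightarrow> b \<in> roe_alg \<Longrightarrow> \<Phi> a (\<Phi> b f) = \<Phi> (a \<circ> b) f"
  by (simp add: phi_comp)

lemma phi_inner:
  "a \<in> roe_alg \<Longrightarrow> f \<in> l2 \<Longrightarrow> g \<in> l2 \<Longrightarrow> l2_inner (\<Phi> a f) g = l2_inner f (\<Phi> (adj a) g)"
  by (simp add: phi_adj inner_adj_right)

lemma p_phi [simp]: "a \<in> roe_alg \<Longrightarrow> p (\<Phi> a f) = \<Phi> a f"
  and phi_p [simp]: "a \<in> roe_alg \<Longrightarrow> \<Phi> a (p f) = \<Phi> a f"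
  by (simp_all add: phi_comp_apply)

lemma p_inner: "f \<in> l2 \<Longrightarrow> g \<in> l2 \<Longrightarrow> l2_inner (p f) g = l2_inner f (p g)"
  by (simp add: phi_inner)

lemma e_nonzero [simp]: "e x \<noteq> 0"
proof
  assume "e x = 0"
  hence "e x (delta x) = 0 (delta x)" by (rule fun_cong)
  thus False by simp
qed

section \<open>The isometry attached to a vector\<close>

lemma phi_rank1_norm_square:
  assumes h: "h \<in> l2" and \<xi>: "\<xi> \<in> l2"
  shows "of_real ((l2_norm (\<Phi> (rank1 \<xi> (delta x)) h))\<^sup>2) =
    of_real ((l2_norm \<xi>)\<^sup>2) * l2_inner h (\<Phi> (e x) h)"
proof -
  \<comment> \<open>The direction of \<open>\<xi>\<close> drops out of this product and only its
    norm survives; everything isometric about the construction comes from here.\<close>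
  have eq: "adj (rank1 \<xi> (delta x)) \<circ> rank1 \<xi> (delta x) = op_scale (of_real ((l2_norm \<xi>)\<^sup>2)) (e x)"
    using \<xi> by (simp add: comp_rank1 rank1_scale_left l2_inner_self)
  have r: "rank1 \<xi> (delta x) \<in> roe_alg" using \<xi> by auto
  have "of_real ((l2_norm (\<Phi> (rank1 \<xi> (delta x)) h))\<^sup>2) =
      l2_inner (\<Phi> (rank1 \<xi> (delta x)) h) (\<Phi> (rank1 \<xi> (delta x)) h)"
    by (rule l2_inner_self[symmetric])
  also have "\<dots> = l2_inner h (\<Phi> (adj (rank1 \<xi> (delta x))) (\<Phi> (rank1 \<xi> (delta x)) h))"
    using h r by (intro phi_inner) auto
  also have "\<dots> = l2_inner h (\<Phi> (op_scale (of_real ((l2_norm \<xi>)\<^sup>2)) (e x)) h)"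
    using r by (simp only: phi_comp_apply roe_adj eq)
  finally show ?thesis by (simp add: phi_scale l2_inner_simps)
qed

text \<open>The instance of the unit vector \<open>\<xi> = delta x\<close>. It turns
  \<open>\<Phi> (e x) h \<noteq> 0\<close> into a nonzero inner product with
  \<open>h\<close>.\<close>

lemma phi_e_norm_square:
  "h \<in> l2 \<Longrightarrow> l2_inner h (\<Phi> (e x) h) = of_real ((l2_norm (\<Phi> (e x) h))\<^sup>2)"
  using phi_rank1_norm_square[of h "delta x" x] by simp

lemma phi_rank1_norm:
  assumes "h \<in> l2" "\<xi> \<in> l2"
  shows "l2_norm (\<Phi> (rank1 \<xi> (delta x)) h) = l2_norm \<xi> * l2_norm (\<Phi> (e x) h)"
proof (rule power2_eq_imp_eq)
  have "complex_of_real ((l2_norm (\<Phi> (rank1 \<xi> (delta x)) h))\<^sup>2) =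
      of_real ((l2_norm \<xi> * l2_norm (\<Phi> (e x) h))\<^sup>2)"
    unfolding phi_rank1_norm_square[OF assms] phi_e_norm_square[OF assms(1)]
    by (simp add: power_mult_distrib)
  thus "(l2_norm (\<Phi> (rank1 \<xi> (delta x)) h))\<^sup>2 = (l2_norm \<xi> * l2_norm (\<Phi> (e x) h))\<^sup>2"
    using of_real_eq_iff by blast
qed auto

text \<open>Defining the isometry on all of \<open>l2\<close> at once, and not only on basis vectors, makes the
  automatic continuity of \<open>\<Phi>\<close> unnecessary.\<close>

lemma spatial_criterion:
  assumes h: "h \<in> l2" and nz: "\<Phi> (e x) h \<noteq> 0"
    and full: "\<And>w. w \<in> l2 \<Longrightarrow> p w = w \<Longrightarrow>
      (\<And>\<xi>. \<xi> \<in> l2 \<Longrightarrow> l2_inner (\<Phi> (rank1 \<xi> (delta x)) h) w = 0) \<Longrightarrow> w = 0"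
  shows "\<exists>u :: ('x, 'y) op. l2_isometry u \<and> (\<forall>a\<in>roe_alg. \<Phi> a = u \<circ> a \<circ> adj u)"
proof -
  define n where "n = l2_norm (\<Phi> (e x) h)"
  have n: "n > 0" using nz h by (simp add: n_def l2_norm_pos_iff)
  define u where "u = (\<lambda>\<xi>. if \<xi> \<in> l2 then vscale (of_real (1 / n)) (\<Phi> (rank1 \<xi> (delta x)) h) else 0)"
  have u_norm: "l2_norm (u \<xi>) = l2_norm \<xi>" if "\<xi> \<in> l2" for \<xi>
    using that h n by (simp add: u_def phi_rank1_norm norm_divide flip: n_def)
  have u: "bounded_op u"
  proof (rule bounded_opI[where C=1])
    show "u (f + g) = u f + u g" if "f \<in> l2" "g \<in> l2" for f g
      using that by (simp add: u_def rank1_add_left phi_plus vs.scale_right_distrib)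
    show "u (vscale c f) = vscale c (u f)" if "f \<in> l2" for c f
      using that by (simp add: u_def rank1_scale_left phi_scale mult.commute)
    show "u f \<in> l2" if "f \<in> l2" for f
      using that h by (simp add: u_def)
    show "l2_norm (u f) \<le> 1 * l2_norm f" if "f \<in> l2" for f
      using that by (simp add: u_norm)
    show "u f = 0" if "f \<notin> l2" for f
      using that by (simp add: u_def)
  qed
  have iso: "l2_isometry u" using u u_norm by (simp add: l2_isometry_def)
  have uu: "adj u (u f) = f" if "f \<in> l2" for f
    using isometry_adj_comp[OF iso] that by (metis comp_apply id_op_apply)
  \<comment> \<open>Left multiplication touches only the first vector:
    \<open>a \<circ> rank1 \<xi> (delta x) = rank1 (a \<xi>) (delta x)\<close>.\<close>
  have inter: "\<Phi> a (u \<xi>) = u (a \<xi>)" if "a \<in> roe_alg" "\<xi> \<in> l2" for a \<xi>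
    using that h
    by (simp add: u_def bounded_op_scale phi_comp_apply comp_rank1)
  have adjp: "adj u (p f) = adj u f" if f: "f \<in> l2" for f
  proof (rule l2_eqI_inner)
    fix g :: "'x vec" assume g: "g \<in> l2"
    have "l2_inner (u g) (p f) = l2_inner (p (u g)) f"
      using u f g by (simp add: p_inner)
    also have "\<dots> = l2_inner (u g) f" using g by (simp add: inter)
    finally show "l2_inner g (adj u (p f)) = l2_inner g (adj u f)"
      using u f g by (simp add: inner_adj_right)
  qed
  \<comment> \<open>The defect \<open>w\<close> of this equation is fixed by \<open>p\<close> and
    orthogonal to the range of \<open>u\<close>, exactly the kind of vector that \<open>full\<close>
    excludes.\<close>
  have puu: "p f = u (adj u f)" if f: "f \<in> l2" for f
  proof -
    define w where "w = p f - u (adj u f)"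
    have w: "w \<in> l2" using u f by (simp add: w_def)
    moreover have "p w = w"
      using u f by (simp add: w_def bounded_op_diff inter)
    moreover have "l2_inner (\<Phi> (rank1 \<xi> (delta x)) h) w = 0" if \<xi>: "\<xi> \<in> l2" for \<xi>
    proof -
      have "l2_inner (u \<xi>) w = l2_inner \<xi> (adj u w)"
        using u w \<xi> by (simp add: inner_adj_right)
      also have "adj u w = 0"
        using u f by (simp add: w_def bounded_op_diff adjp uu)
      finally show ?thesis using \<xi> n by (simp add: u_def l2_inner_simps)
    qed
    ultimately have "w = 0" by (rule full)
    thus ?thesis by (simp add: w_def)
  qed
  have "\<Phi> a = u \<circ> a \<circ> adj u" if a: "a \<in> roe_alg" for a
  proof (rule bounded_op_eqI)
    fix f :: "'y vec" assume f: "f \<in> l2"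
    have "\<Phi> a f = \<Phi> a (p f)" using a by simp
    also have "\<dots> = u (a (adj u f))" using a f u by (simp only: puu) (simp add: inter)
    finally show "\<Phi> a f = (u \<circ> a \<circ> adj u) f" by simp
  qed (use a u in auto)
  thus ?thesis using iso by blast
qed

section \<open>A spatial implementation preserves rank and is strongly continuous\<close>

lemma spatial_imp_rank_preserving:
  assumes "l2_isometry u" "\<And>a. a \<in> roe_alg \<Longrightarrow> \<Phi> a = u \<circ> a \<circ> adj u"
  shows "rank_preserving \<Phi> roe_alg"
  unfolding rank_preserving_def
proof
  fix a :: "('x, 'x) op" assume a: "a \<in> roe_alg"
  have u: "bounded_op u" using assms by (simp add: l2_isometry_def)
  have uu: "adj u (u f) = f" if "f \<in> l2" for f
    using isometry_adj_comp[OF assms(1)] that by (metis comp_apply id_op_apply)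
  \<comment> \<open>Since \<open>adj u\<close> is a left inverse of \<open>u\<close>, each of
    \<open>a\<close> and \<open>\<Phi> a\<close> is obtained from the other by composition, and
    composition cannot raise the rank.\<close>
  have "a = adj u \<circ> \<Phi> a \<circ> u"
    by (rule bounded_op_eqI) (use a u in \<open>auto simp: assms(2) uu\<close>)
  hence "op_rank a \<le> op_rank (\<Phi> a)"
    using op_rank_comp_le[of "adj u" "\<Phi> a" u] a u by simp
  moreover have "op_rank (\<Phi> a) \<le> op_rank a"
    using op_rank_comp_le[of u a "adj u"] a u by (simp add: assms(2))
  ultimately show "op_rank (\<Phi> a) = op_rank a" by simp
qed

text \<open>The difference \<open>\<Phi> b f - \<Phi> a f\<close> is the isometric image of
  \<open>(b - a) (adj u f)\<close>, so the error at \<open>f\<close> equals the error at the fixed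
  vector \<open>adj u f\<close>.\<close>

lemma spatial_imp_strongly_continuous:
  assumes "l2_isometry u" "\<And>a. a \<in> roe_alg \<Longrightarrow> \<Phi> a = u \<circ> a \<circ> adj u"
  shows "strongly_continuous \<Phi> roe_alg"
  unfolding strongly_continuous_def
proof (intro allI impI, elim conjE)
  fix R a and F :: "('x, 'x) op filter"
  assume a: "a \<in> roe_alg" and ev: "\<forall>\<^sub>F b in F. b \<in> roe_alg \<and> op_norm b \<le> R"
    and lim: "sot_tendsto id a F"
  have u: "bounded_op u" using assms by (simp add: l2_isometry_def)
  show "sot_tendsto \<Phi> (\<Phi> a) F"
    unfolding sot_tendsto_def
  proof
    fix f :: "'y vec" assume f: "f \<in> l2"
    have "((\<lambda>b. l2_norm (b (adj u f) - a (adj u f))) \<longlongrightarrow> 0) F"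
      using lim u f by (simp add: sot_tendsto_def)
    moreover have "\<forall>\<^sub>F b in F. l2_norm (b (adj u f) - a (adj u f)) = l2_norm (vsub (\<Phi> b f) (\<Phi> a f))"
      using ev
    proof eventually_elim
      case (elim b)
      have "u (b (adj u f)) - u (a (adj u f)) = u (b (adj u f) - a (adj u f))"
        using a elim f u by (simp add: bounded_op_diff)
      moreover have "l2_norm (u g) = l2_norm g" if "g \<in> l2" for g
        using that assms(1) by (simp add: l2_isometry_def)
      ultimately show ?case using a elim f u by (simp add: assms(2))
    qed
    ultimately show "((\<lambda>b. l2_norm (vsub (\<Phi> b f) (\<Phi> a f))) \<longlongrightarrow> 0) F"
      by (rule Lim_transform_eventually)
  qed
qed

section \<open>Rank preservation and strong continuity give a spatial implementation\<close>

lemma phi_e_nonzero: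
  obtains h where "h \<in> l2" "\<Phi> (e x) h \<noteq> 0"
proof -
  have "\<Phi> (e x) \<noteq> 0" using phi_eq_0D[of "e x"] by auto
  then obtain h where "\<Phi> (e x) h \<noteq> 0" by (auto simp: fun_eq_iff)
  moreover from this have "h \<in> l2" using bounded_op_outside[of "\<Phi> (e x)" h] by auto
  ultimately show thesis using that by blast
qed

lemma rank_preserving_strongly_continuous_imp_spatial:
  assumes rank: "rank_preserving \<Phi> roe_alg" and sc: "strongly_continuous \<Phi> roe_alg"
  shows "\<exists>u :: ('x, 'y) op. l2_isometry u \<and> (\<forall>a\<in>roe_alg. \<Phi> a = u \<circ> a \<circ> adj u)"
proof -
  \<comment> \<open>Any base point will do, and \<open>undefined\<close> names one since types are
    inhabited.\<close>
  define x :: 'x where "x = undefined"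
  obtain h where h: "h \<in> l2" "\<Phi> (e x) h \<noteq> 0" by (rule phi_e_nonzero)
  show ?thesis
  proof (rule spatial_criterion[OF h])
    fix w :: "'y vec"
    assume w: "w \<in> l2" "p w = w"
      and orth: "\<And>\<xi>. \<xi> \<in> l2 \<Longrightarrow> l2_inner (\<Phi> (rank1 \<xi> (delta x)) h) w = 0"
    have ew: "\<Phi> (e y) w = 0" for y
    proof -
      \<comment> \<open>Up to normalisation the image of \<open>delta y\<close> under the isometry.
        It is a nonzero vector in the range of \<open>\<Phi> (e y)\<close>, hence spans that range
        when the rank is at most one, and it is orthogonal to \<open>w\<close>.\<close>
      define v where "v = \<Phi> (rank1 (delta y) (delta x)) h"
      have v: "v \<in> l2" "l2_inner v w = 0"
        using orth[of "delta y"] by (simp_all add: v_def)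
      have ev: "\<Phi> (e y) v = v"
        by (simp add: v_def phi_comp_apply comp_rank1)
      have "l2_norm v = l2_norm (\<Phi> (e x) h)"
        using phi_rank1_norm[OF h(1) delta_l2, of y x] by (simp add: v_def)
      hence vnz: "v \<noteq> 0" using h by auto
      have "e y f \<in> vs.span {delta y}" if "f \<in> l2" for f
        using that by (simp add: vs.span_scale vs.span_base)
      hence "op_rank (e y) \<le> enat 1"
        using op_rank_le[of "{delta y}" "e y"] by (auto simp: one_enat_def)
      hence "op_rank (\<Phi> (e y)) \<le> enat 1"
        using rank by (simp add: rank_preserving_def)
      then obtain F where F: "finite F" "card F \<le> 1" "\<Phi> (e y) ` l2 \<subseteq> vs.span F"
        by (rule op_rank_leD)
      have vF: "v \<in> vs.span F" and wF: "\<Phi> (e y) w \<in> vs.span F"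
        using F(3) v(1) w(1) ev by (metis image_subset_iff)+
      \<comment> \<open>The bound \<open>card F \<le> 1\<close> still admits the empty set, which
        the nonzero \<open>v\<close> rules out.\<close>
      have "F \<noteq> {}" using vF vnz by auto
      then obtain b where b: "F = {b}"
        using F(1,2) by (metis card_1_singletonE card_gt_0_iff le_antisym less_eq_Suc_le One_nat_def)
      obtain c d where c: "v = vscale c b" and d: "\<Phi> (e y) w = vscale d b"
        using vF wF unfolding b vs.span_singleton by blast
      have "c \<noteq> 0" using vnz c by auto
      hence "\<Phi> (e y) w = vscale (d / c) v" using c d by simp
      \<comment> \<open>\<open>\<Phi> (e y)\<close> is a self-adjoint idempotent, so the squared
        norm of \<open>\<Phi> (e y) w\<close> is its inner product with \<open>w\<close>. As a
        multiple of \<open>v\<close> it is orthogonal to \<open>w\<close>.\<close>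
      moreover have "l2_inner (\<Phi> (e y) w) (\<Phi> (e y) w) = l2_inner (\<Phi> (e y) w) w"
        using w by (simp add: phi_inner phi_comp_apply comp_rank1)
      ultimately have "l2_inner (\<Phi> (e y) w) (\<Phi> (e y) w) = 0"
        using v(2) by (simp add: l2_inner_simps)
      thus ?thesis using w by (simp add: l2_inner_self)
    qed
    have tw: "\<Phi> (trunc_op F) w = 0" if "finite F" for F
      using that
    proof (induction F rule: finite_induct)
      case empty
      show ?case unfolding trunc_op_empty phi_zero by (rule op_zero_apply)
    next
      case (insert y F)
      have "\<Phi> (trunc_op (insert y F)) = \<Phi> (e y) + \<Phi> (trunc_op F)"
        unfolding trunc_op_insert[OF insert(2)] by (rule phi_plus) auto
      thus ?case using insert by (simp add: ew)
    qed
    \<comment> \<open>The finite coordinate projections stay in the unit ball and tend strongly to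
      the identity. Their images all kill \<open>w\<close>, while strong continuity makes the images
      tend to \<open>p w = w\<close>.\<close>
    let ?F = "filtermap trunc_op (finite_subsets_at_top (UNIV :: 'x set))"
    have "sot_tendsto id id_op ?F"
      unfolding sot_tendsto_def filterlim_filtermap
      by (auto simp: l2_norm_minus_commute[of "trunc _ _"] intro: trunc_tendsto)
    moreover have "\<forall>\<^sub>F b in ?F. b \<in> roe_alg \<and> op_norm b \<le> 1"
      by (simp add: eventually_filtermap op_norm_trunc_op_le)
    moreover have "op_norm (id_op :: ('x, 'x) op) \<le> 1"
      by (rule op_norm_le) simp
    ultimately have "sot_tendsto \<Phi> p ?F"
      using sc unfolding strongly_continuous_def by blast
    hence "((\<lambda>F. l2_norm (\<Phi> (trunc_op F) w - w)) \<longlongrightarrow> 0) (finite_subsets_at_top UNIV)"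
      using w unfolding sot_tendsto_def filterlim_filtermap by force
    moreover have "\<forall>\<^sub>F F in finite_subsets_at_top UNIV. l2_norm (\<Phi> (trunc_op F) w - w) = l2_norm w"
      by (rule eventually_finite_subsets_at_top_weakI) (simp add: tw)
    ultimately have "((\<lambda>F. l2_norm w) \<longlongrightarrow> 0) (finite_subsets_at_top (UNIV :: 'x set))"
      by (rule Lim_transform_eventually)
    hence "l2_norm w = 0" by (simp add: tendsto_const_iff)
    thus "w = 0" using w by simp
  qed
qed

section \<open>A spatial implementation reaches the compact operators of the corner\<close>

lemma spatial_imp_corner_compacts:
  assumes "l2_isometry u" "\<And>a. a \<in> roe_alg \<Longrightarrow> \<Phi> a = u \<circ> a \<circ> adj u" "compact_op k"
  shows "p \<circ> k \<circ> p \<in> \<Phi> ` roe_alg"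
proof -
  have u: "bounded_op u" using assms by (simp add: l2_isometry_def)
  \<comment> \<open>This compression is the preimage sought: with \<open>p = u \<circ> adj u\<close>
    its image is \<open>p \<circ> k \<circ> p\<close>, and compactness places it in the uniform Roe
    algebra.\<close>
  have k: "adj u \<circ> k \<circ> u \<in> roe_alg"
    using u assms(3) by (intro compact_op_roe compact_op_comp_right compact_op_comp_left) auto
  have "p = u \<circ> adj u" using assms(2)[of id_op] u by auto
  hence "p \<circ> k \<circ> p = \<Phi> (adj u \<circ> k \<circ> u)"
    using assms(2)[OF k] by (simp only: o_assoc)
  thus ?thesis using k by blast
qed

section \<open>The corner cut out by \<open>p\<close>, an upper bound for the generated hereditary
  subalgebra\<close>

definition corner :: "('y, 'y) op set" where
  "corner = {b \<in> roe_alg. (\<forall>f\<in>l2. p (b f) = b f \<and> b (p f) = b f)}"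

lemma phi_corner: "\<Phi> ` roe_alg \<subseteq> corner"
  by (auto simp: corner_def)

text \<open>The defects \<open>p (T f) - T f\<close> and \<open>T (p f) - T f\<close> vanish for
  operators in the corner and, for fixed \<open>f\<close>, depend continuously on \<open>T\<close>
  in norm.\<close>

lemma corner_closed:
  assumes T: "bounded_op T" and approx: "\<And>\<epsilon>. \<epsilon> > 0 \<Longrightarrow> \<exists>S\<in>corner. op_norm (T - S) < \<epsilon>"
  shows "T \<in> corner"
proof -
  have "T \<in> roe_alg"
    using approx by (intro roe_limitI T) (auto simp: corner_def)
  moreover have "p (T f) = T f \<and> T (p f) = T f" if f: "f \<in> l2" for f
  proof -
    have small: "l2_norm (p (T f) - T f) + l2_norm (T (p f) - T f) \<le> 0 + \<epsilon>" if "\<epsilon> > 0" for \<epsilon>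
    proof -
      \<comment> \<open>The sum of the factors multiplying \<open>d\<close> in the two estimates
        below, plus 1 to make it positive.\<close>
      define C where "C = op_norm p * l2_norm f + l2_norm f + l2_norm (p f) + l2_norm f + 1"
      have C: "C > 0" unfolding C_def by (intro add_nonneg_pos add_nonneg_nonneg) auto
      obtain S where S: "S \<in> corner" "op_norm (T - S) < \<epsilon> / C"
        using approx[of "\<epsilon> / C"] C \<open>\<epsilon> > 0\<close> by auto
      have Sb: "bounded_op S" using S by (simp add: corner_def)
      define d where "d = op_norm (T - S)"
      have d: "d \<ge> 0" using T Sb by (simp add: d_def)
      have bd: "l2_norm (T g - S g) \<le> d * l2_norm g" if "g \<in> l2" for g
        using op_norm_bound[of "T - S" g] T Sb that by (simp add: d_def)
      have pS: "p (S f) = S f" "S (p f) = S f" using S f by (auto simp: corner_def)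
      have "p (T f) - T f = p (T f - S f) + (S f - T f)"
        using T Sb f pS by (simp add: bounded_op_diff)
      hence "l2_norm (p (T f) - T f) \<le> l2_norm (p (T f - S f)) + l2_norm (S f - T f)"
        using T Sb f by (simp only:) (intro l2_norm_triangle, auto)
      also have "\<dots> \<le> op_norm p * l2_norm (T f - S f) + l2_norm (T f - S f)"
        using T Sb f by (intro add_mono op_norm_bound) (auto simp: l2_norm_minus_commute)
      also have "\<dots> \<le> op_norm p * (d * l2_norm f) + d * l2_norm f"
        using f by (intro add_mono mult_left_mono bd) auto
      finally have 1: "l2_norm (p (T f) - T f) \<le> d * (op_norm p * l2_norm f + l2_norm f)"
        by (simp add: algebra_simps)
      have "T (p f) - T f = (T (p f) - S (p f)) + (S f - T f)"
        using pS by simp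
      hence "l2_norm (T (p f) - T f) \<le> l2_norm (T (p f) - S (p f)) + l2_norm (S f - T f)"
        using T Sb f by (simp only:) (intro l2_norm_triangle, auto)
      also have "\<dots> \<le> d * l2_norm (p f) + d * l2_norm f"
        using f bd[of f] by (intro add_mono bd) (auto simp: l2_norm_minus_commute)
      finally have 2: "l2_norm (T (p f) - T f) \<le> d * (l2_norm (p f) + l2_norm f)"
        by (simp add: algebra_simps)
      have "l2_norm (p (T f) - T f) + l2_norm (T (p f) - T f) \<le> d * C"
        using 1 2 d by (simp add: C_def algebra_simps)
      also have "\<dots> \<le> \<epsilon>" using S(2) C by (simp add: d_def field_simps)
      finally show ?thesis by simp
    qed
    have "l2_norm (p (T f) - T f) + l2_norm (T (p f) - T f) \<le> 0"
      by (rule field_le_epsilon) (rule small)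
    hence "l2_norm (p (T f) - T f) = 0" "l2_norm (T (p f) - T f) = 0"
      using l2_norm_nonneg[of "p (T f) - T f"] l2_norm_nonneg[of "T (p f) - T f"] by linarith+
    thus ?thesis using T f by simp
  qed
  ultimately show ?thesis by (simp add: corner_def)
qed

lemma corner_cstar_subalg: "cstar_subalg corner"
  unfolding cstar_subalg_def
proof (intro conjI ballI allI impI)
  fix a b :: "('y, 'y) op" and c :: complex assume a: "a \<in> corner"
  show "bounded_op a" using a by (simp add: corner_def)
  show "op_scale c a \<in> corner" using a by (auto simp: corner_def bounded_op_scale)
  show "adj a \<in> corner"
  proof -
    \<comment> \<open>Since \<open>p\<close> is self-adjoint, taking adjoints exchanges the left and
      the right absorption condition.\<close>
    have "p (adj a f) = adj a f \<and> adj a (p f) = adj a f" if f: "f \<in> l2" for f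
    proof
      show "p (adj a f) = adj a f"
      proof (rule l2_eqI_inner)
        fix g :: "'y vec" assume "g \<in> l2"
        thus "l2_inner g (p (adj a f)) = l2_inner g (adj a f)"
          using a f by (simp add: corner_def inner_adj_right flip: p_inner)
      qed
      show "adj a (p f) = adj a f"
      proof (rule l2_eqI_inner)
        fix g :: "'y vec" assume "g \<in> l2"
        thus "l2_inner g (adj a (p f)) = l2_inner g (adj a f)"
          using a f by (simp add: corner_def inner_adj_right flip: p_inner)
      qed
    qed
    thus ?thesis using a by (auto simp: corner_def)
  qed
  assume b: "b \<in> corner"
  show "op_add a b \<in> corner" using a b by (auto simp: corner_def bounded_op_add)
  show "a \<circ> b \<in> corner" using a b by (auto simp: corner_def)
next
  show "op_zero \<in> corner" by (auto simp: corner_def)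
next
  fix T :: "('y, 'y) op"
  assume "bounded_op T \<and> (\<forall>\<epsilon>>0. \<exists>S\<in>corner. op_norm (op_sub T S) < \<epsilon>)"
  thus "T \<in> corner" by (intro corner_closed) auto
qed

text \<open>On \<open>g = f - p f\<close> the larger operator \<open>b\<close> vanishes, so the form
  of \<open>a\<close> at \<open>g\<close> is squeezed to 0 and \<open>positive_op_kernel\<close>
  gives \<open>a g = 0\<close>. Absorption on the left then follows from self-adjointness of
  \<open>a\<close>.\<close>

lemma corner_hereditary: "hereditary_subalg roe_alg corner"
  unfolding hereditary_subalg_def
proof (intro conjI ballI impI)
  fix a b :: "('y, 'y) op"
  assume a: "a \<in> roe_alg" and b: "b \<in> corner" and le: "op_le op_zero a \<and> op_le a b"
  have pos: "positive_op a" "positive_op (b - a)" using le by (auto simp: op_le_def)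
  have ap: "a (p f) = a f" if f: "f \<in> l2" for f
  proof -
    define g where "g = f - p f"
    have g: "g \<in> l2" using f by (simp add: g_def)
    have bb: "bounded_op b" and bp: "b (p f) = b f" using b f by (auto simp: corner_def)
    have "b g = 0" using f bb bp by (simp add: g_def bounded_op_diff)
    hence "l2_inner g ((b - a) g) = - l2_inner g (a g)" using g a by simp
    hence "l2_inner g (a g) = 0"
      using pos g unfolding positive_op_def by (force simp: complex_eq_iff)
    hence "a g = 0" using pos g by (intro positive_op_kernel)
    thus ?thesis using f a by (simp add: g_def bounded_op_diff)
  qed
  moreover have "p (a f) = a f" if f: "f \<in> l2" for f
  proof (rule l2_eqI_inner)
    fix g :: "'y vec" assume g: "g \<in> l2"
    have sa: "l2_inner (a h) f = l2_inner h (a f)" if "h \<in> l2" for h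
      using inner_adj_right[of a f h] that a f positive_op_adj[OF pos(1)] by simp
    have "l2_inner g (p (a f)) = l2_inner (p g) (a f)" using a f g by (simp add: p_inner)
    also have "\<dots> = l2_inner (a (p g)) f" using g by (simp add: sa)
    also have "\<dots> = l2_inner g (a f)" using g by (simp add: ap sa)
    finally show "l2_inner g (p (a f)) = l2_inner g (a f)" .
  qed
  ultimately show "a \<in> corner" using a by (simp add: corner_def)
qed (use corner_cstar_subalg in \<open>auto simp: corner_def\<close>)

text \<open>Through this inclusion every element of the generated subalgebra is absorbed by
  \<open>p\<close> on both sides, the property behind the ideal laws and essentiality below.\<close>

lemma hereditary_gen_corner: "hereditary_gen roe_alg (\<Phi> ` roe_alg) \<subseteq> corner"
  unfolding hereditary_gen_def using corner_hereditary phi_corner by blast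

lemma phi_hereditary_gen: "\<Phi> ` roe_alg \<subseteq> hereditary_gen roe_alg (\<Phi> ` roe_alg)"
  unfolding hereditary_gen_def by blast

section \<open>Compact operators on the range of \<open>p\<close> as an essential ideal\<close>

definition range_p :: "'y vec set" where
  "range_p = {f \<in> l2. p f = f}"

lemma range_p_closed_subspace: "closed_l2_subspace range_p"
  unfolding closed_l2_subspace_def
proof (intro conjI ballI allI impI, goal_cases)
  \<comment> \<open>Case 5 is sequential closedness: \<open>p g - g\<close> is estimated through
    \<open>s n\<close>, which \<open>p\<close> fixes.\<close>
  case (5 s g)
  hence s: "\<And>n. s n \<in> l2" "\<And>n. p (s n) = s n" and g: "g \<in> l2"
    and lim: "(\<lambda>n. l2_norm (s n - g)) \<longlonglongrightarrow> 0"
    by (auto simp: range_p_def)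
  have "l2_norm (p g - g) \<le> op_norm p * l2_norm (s n - g) + l2_norm (s n - g)" for n
  proof -
    have "l2_norm (p g - g) \<le> l2_norm (p g - s n) + l2_norm (s n - g)"
      using s g by (intro l2_norm_triangle_diff) auto
    also have "p g - s n = p (g - s n)" using s g by (simp add: bounded_op_diff)
    also have "l2_norm (p (g - s n)) \<le> op_norm p * l2_norm (g - s n)"
      using s g by (intro op_norm_bound) auto
    finally show ?thesis by (simp add: l2_norm_minus_commute)
  qed
  moreover have "(\<lambda>n. op_norm p * l2_norm (s n - g) + l2_norm (s n - g)) \<longlonglongrightarrow> op_norm p * 0 + 0"
    by (intro tendsto_intros lim)
  ultimately have "l2_norm (p g - g) \<le> op_norm p * 0 + 0"
    by (intro tendsto_lowerbound[where F=sequentially]) auto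
  hence "l2_norm (p g - g) = 0" by (simp add: order_antisym)
  thus ?case using g by (simp add: range_p_def)
qed (auto simp: range_p_def bounded_op_add bounded_op_scale)

text \<open>Converts the orthogonality clause in \<open>compacts_on\<close> into an equation for
  \<open>p\<close>, because the squared norm of \<open>p f\<close> is
  \<open>l2_inner (p f) f\<close>.\<close>

lemma p_eq_0_if_orthogonal:
  assumes "f \<in> l2" "\<forall>h\<in>range_p. l2_inner h f = 0"
  shows "p f = 0"
proof -
  have "p f \<in> range_p" using assms by (simp add: range_p_def)
  hence "l2_inner (p f) f = 0" using assms by blast
  moreover have "l2_inner (p f) (p f) = l2_inner (p f) f"
    using assms by (simp flip: p_inner)
  ultimately show ?thesis using assms by (simp add: l2_inner_self)
qed

text \<open>Puts such operators in the form covered by (3). The vector \<open>f - p f\<close> is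
  orthogonal to the range of \<open>p\<close>, so \<open>k\<close> kills it.\<close>

lemma compacts_on_range_p_absorb:
  assumes "k \<in> compacts_on range_p"
  shows "p \<circ> k \<circ> p = k"
proof (rule bounded_op_eqI)
  have k: "bounded_op k" using assms by (simp add: compacts_on_def)
  thus "bounded_op (p \<circ> k \<circ> p)" "bounded_op k" by auto
  fix f :: "'y vec" assume f: "f \<in> l2"
  have "l2_inner h (f - p f) = 0" if "h \<in> range_p" for h
    using that f by (simp add: range_p_def l2_inner_simps flip: p_inner)
  hence "k (f - p f) = 0" using assms f by (auto simp: compacts_on_def)
  hence "k (p f) = k f" using f k by (simp add: bounded_op_diff)
  moreover have "k f \<in> range_p" using assms f by (auto simp: compacts_on_def)
  ultimately show "(p \<circ> k \<circ> p) f = k f" by (simp add: range_p_def)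
qed

lemma corner_compacts_imp_essential:
  assumes corner: "\<And>k. compact_op k \<Longrightarrow> p \<circ> k \<circ> p \<in> \<Phi> ` roe_alg"
  shows "\<exists>H. closed_l2_subspace H \<and> compacts_on H \<subseteq> \<Phi> ` roe_alg \<and>
    essential_ideal (compacts_on H) (hereditary_gen roe_alg (\<Phi> ` roe_alg))"
proof (intro exI conjI)
  let ?D = "hereditary_gen roe_alg (\<Phi> ` roe_alg)"
  let ?K = "compacts_on range_p"
  show "closed_l2_subspace range_p" by (rule range_p_closed_subspace)
  show sub: "?K \<subseteq> \<Phi> ` roe_alg"
  proof
    fix k assume "k \<in> ?K"
    thus "k \<in> \<Phi> ` roe_alg"
      using corner[of k] compacts_on_range_p_absorb[of k] by (simp add: compacts_on_def)
  qed
  have D: "d \<in> roe_alg" "f \<in> l2 \<Longrightarrow> p (d f) = d f" "f \<in> l2 \<Longrightarrow> d (p f) = d f"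
    if "d \<in> ?D" for d f
    using that hereditary_gen_corner by (auto simp: corner_def)
  \<comment> \<open>Stating the range condition as an equation for \<open>p\<close> reduces the
    ideal laws to short computations.\<close>
  have KI: "k \<in> ?K"
    if "compact_op k" "\<And>f. f \<in> l2 \<Longrightarrow> p (k f) = k f"
      "\<And>f. f \<in> l2 \<Longrightarrow> \<forall>h\<in>range_p. l2_inner h f = 0 \<Longrightarrow> k f = 0" for k
    using that by (auto simp: compacts_on_def range_p_def)
  have K: "compact_op k" "f \<in> l2 \<Longrightarrow> p (k f) = k f"
      "f \<in> l2 \<Longrightarrow> \<forall>h\<in>range_p. l2_inner h f = 0 \<Longrightarrow> k f = 0" if "k \<in> ?K" for k f
    using that by (auto simp: compacts_on_def range_p_def)
  have ideal: "is_ideal ?K ?D"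
    unfolding is_ideal_def op_add_eq_plus op_zero_eq_zero
  proof (intro conjI ballI allI)
    show "?K \<subseteq> ?D" using sub phi_hereditary_gen by blast
    show "0 \<in> ?K" by (rule KI) auto
    fix j assume j: "j \<in> ?K"
    have jb: "bounded_op j" using K(1)[OF j] by simp
    show "op_scale c j \<in> ?K" for c
      by (rule KI) (use jb K[OF j] in \<open>auto simp: bounded_op_scale\<close>)
    show "j + k \<in> ?K" if k: "k \<in> ?K" for k
      by (rule KI) (use jb K[OF j] K[OF k] in \<open>auto simp: bounded_op_add\<close>)
    fix d assume d: "d \<in> ?D"
    have db: "bounded_op d" using D(1)[OF d] by simp
    show "d \<circ> j \<in> ?K"
      by (rule KI) (use jb db K[OF j] D[OF d] in auto)
    show "j \<circ> d \<in> ?K"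
    proof (rule KI)
      fix f :: "'y vec" assume f: "f \<in> l2" "\<forall>h\<in>range_p. l2_inner h f = 0"
      have "d f = d (p f)" using d f by (simp add: D)
      also have "\<dots> = 0" using p_eq_0_if_orthogonal[OF f] db by simp
      finally show "(j \<circ> d) f = 0" using jb by simp
    qed (use jb db K[OF j] in auto)
  qed
  show "essential_ideal ?K ?D"
    unfolding essential_ideal_def
  proof (intro conjI ballI impI ideal)
    fix d assume d: "d \<in> ?D" and ann: "\<forall>j\<in>?K. d \<circ> j = op_zero"
    have db: "bounded_op d" using D(1)[OF d] by simp
    have "d f = 0" if f: "f \<in> l2" for f
    proof -
      \<comment> \<open>The rank one operator on the line of \<open>p f\<close> is compact on the
        range of \<open>p\<close>. Being annihilated by \<open>d\<close>, it forces
        \<open>d (p f) = 0\<close>, and \<open>d\<close> does not distinguish \<open>f\<close> from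
        \<open>p f\<close>.\<close>
      have pf: "p f \<in> range_p" using f by (simp add: range_p_def)
      hence "d \<circ> rank1 (p f) (p f) = op_zero"
        using ann rank1_compacts_on[OF range_p_closed_subspace] by blast
      hence "(d \<circ> rank1 (p f) (p f)) (p f) = op_zero (p f)" by (rule fun_cong)
      hence "vscale (l2_inner (p f) (p f)) (d (p f)) = 0"
        using f db by (simp add: bounded_op_scale)
      hence "p f = 0 \<or> d (p f) = 0"
        using f by (auto simp: l2_inner_self)
      hence "d (p f) = 0" using db by auto
      thus ?thesis using D(3)[OF d f] by simp
    qed
    thus "d = op_zero" using db by (intro bounded_op_eqI) auto
  qed
qed

section \<open>An essential ideal of compact operators gives a spatial implementation\<close>

lemma rank1_self_hereditary_gen:
  assumes w: "w \<in> l2" "p w = w"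
  shows "rank1 w w \<in> hereditary_gen roe_alg (\<Phi> ` roe_alg)"
  unfolding hereditary_gen_def
proof (intro InterI, clarify)
  fix B assume B: "hereditary_subalg roe_alg B" "\<Phi> ` roe_alg \<subseteq> B"
  define c where "c = complex_of_real ((l2_norm w)\<^sup>2)"
  have "\<Phi> id_op \<in> B" using B(2) roe_id by blast
  hence cB: "op_scale c p \<in> B"
    using B(1) unfolding hereditary_subalg_def cstar_subalg_def by blast
  have quad: "l2_inner f (rank1 w w f) = of_real ((cmod (l2_inner w f))\<^sup>2)" if "f \<in> l2" for f
    using that complex_norm_square[of "l2_inner w f"] l2_inner_commute[of f w]
    by (simp add: l2_inner_simps)
  have "op_le op_zero (rank1 w w)"
    unfolding op_le_def positive_op_def using w by (auto simp: quad simp del: rank1_apply)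
  moreover have "op_le (rank1 w w) (op_scale c p)"
    unfolding op_le_def positive_op_def op_sub_eq_minus
  proof (intro conjI ballI)
    fix f :: "'y vec" assume f: "f \<in> l2"
    have "l2_inner f (p f) = l2_inner (p f) (p f)"
      using f by (simp add: p_inner)
    hence eq: "l2_inner f ((op_scale c p - rank1 w w) f) =
        of_real ((l2_norm w * l2_norm (p f))\<^sup>2 - (cmod (l2_inner w f))\<^sup>2)"
      using f w quad[OF f]
      by (simp add: l2_inner_simps c_def l2_inner_self power_mult_distrib del: rank1_apply)
    \<comment> \<open>Because \<open>p\<close> fixes \<open>w\<close>, Cauchy-Schwarz can be applied
      to \<open>p f\<close> in place of \<open>f\<close>; this bounds the form by that of a multiple
      of \<open>p\<close>, not merely of the identity.\<close>
    have "l2_inner w f = l2_inner w (p f)" using w f p_inner[of w f] by simp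
    hence "cmod (l2_inner w f) \<le> l2_norm w * l2_norm (p f)"
      using w f l2_Cauchy_Schwarz[of w "p f"] by simp
    hence "(cmod (l2_inner w f))\<^sup>2 \<le> (l2_norm w * l2_norm (p f))\<^sup>2"
      by (intro power_mono) auto
    thus "Im (l2_inner f ((op_scale c p - rank1 w w) f)) = 0"
      "0 \<le> Re (l2_inner f ((op_scale c p - rank1 w w) f))"
      unfolding eq by simp_all
  qed (use w in auto)
  moreover have "rank1 w w \<in> roe_alg" using w by simp
  ultimately show "rank1 w w \<in> B"
    using B(1) cB unfolding hereditary_subalg_def by blast
qed

lemma essential_imp_spatial:
  assumes H: "closed_l2_subspace H" and sub: "compacts_on H \<subseteq> \<Phi> ` roe_alg"
    and ess: "essential_ideal (compacts_on H) (hereditary_gen roe_alg (\<Phi> ` roe_alg))"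
  shows "\<exists>u :: ('x, 'y) op. l2_isometry u \<and> (\<forall>a\<in>roe_alg. \<Phi> a = u \<circ> a \<circ> adj u)"
proof -
  let ?D = "hereditary_gen roe_alg (\<Phi> ` roe_alg)"
  have Hl: "h \<in> l2" if "h \<in> H" for h using H that by (auto simp: closed_l2_subspace_def)
  have annih: "d = 0" if "d \<in> ?D" "\<And>j. j \<in> compacts_on H \<Longrightarrow> d \<circ> j = 0" for d
    using ess that unfolding essential_ideal_def op_zero_eq_zero by blast
  \<comment> \<open>If \<open>H\<close> were zero, \<open>p\<close> would annihilate the compacts on
    \<open>H\<close>, so essentiality would give \<open>p = 0\<close>, against injectivity of
    \<open>\<Phi>\<close>.\<close>
  have "\<exists>h\<in>H. h \<noteq> 0"
  proof (rule ccontr)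
    assume no: "\<not> (\<exists>h\<in>H. h \<noteq> 0)"
    have "p = 0"
    proof (rule annih)
      show "p \<in> ?D" using phi_hereditary_gen roe_id by blast
      fix j assume j: "j \<in> compacts_on H"
      hence jb: "bounded_op j" by (simp add: compacts_on_def)
      show "p \<circ> j = 0"
      proof (rule bounded_op_eqI)
        fix f :: "'y vec" assume "f \<in> l2"
        hence "j f \<in> H" using j by (auto simp: compacts_on_def)
        hence "j f = 0" using no by blast
        thus "(p \<circ> j) f = 0 f" by simp
      qed (use jb in auto)
    qed
    hence "(id_op :: ('x, 'x) op) = 0" by (intro phi_eq_0D) auto
    hence "id_op g = 0 g" for g :: "'x vec" by (rule fun_cong)
    from this[of "delta undefined"] show False by simp
  qed
  then obtain h where h: "h \<in> H" "h \<noteq> 0" by blast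
  have hl: "h \<in> l2" using h Hl by blast
  obtain a where a: "a \<in> roe_alg" "rank1 h h = \<Phi> a"
    using sub rank1_compacts_on[OF H h(1) h(1)] by blast
  \<comment> \<open>Without strong continuity the projections \<open>\<Phi> (e x)\<close> need not
    sum to \<open>p\<close>. The vanishing is instead pulled back along the injective
    \<open>\<Phi>\<close>: every row of \<open>a\<close> would be 0, hence also
    \<open>rank1 h h\<close>.\<close>
  have "\<exists>x. \<Phi> (e x) h \<noteq> 0"
  proof (rule ccontr)
    assume "\<not> (\<exists>x. \<Phi> (e x) h \<noteq> 0)"
    hence z: "\<Phi> (e x) h = 0" for x by blast
    have "e x \<circ> a = 0" for x
    proof (rule phi_eq_0D)
      have "\<Phi> (e x \<circ> a) = \<Phi> (e x) \<circ> rank1 h h" using a by (simp only: phi_comp roe_rank1 delta_l2)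
      also have "\<dots> = rank1 0 h" using hl z by (simp only: comp_rank1 phi_bounded roe_rank1 delta_l2)
      also have "\<dots> = 0" by (rule ext) (simp add: rank1_def)
      finally show "\<Phi> (e x \<circ> a) = 0" .
    qed (use a in auto)
    hence ea: "(e x \<circ> a) f = 0 f" for x f by (rule fun_cong)
    have "a f x = 0" if f: "f \<in> l2" for f x
    proof -
      have "vscale (a f x) (delta x) = 0" using ea[of x f] a f by simp
      thus ?thesis by simp
    qed
    hence "a = 0"
      using a by (intro bounded_op_eqI) (auto simp: fun_eq_iff zero_fun_apply)
    thus False using a h hl rank1_self_eq_0D[of h] by auto
  qed
  then obtain x where x: "\<Phi> (e x) h \<noteq> 0" by blast
  show ?thesis
  proof (rule spatial_criterion[OF hl x])
    fix w :: "'y vec"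
    assume w: "w \<in> l2" "p w = w"
      and orth: "\<And>\<xi>. \<xi> \<in> l2 \<Longrightarrow> l2_inner (\<Phi> (rank1 \<xi> (delta x)) h) w = 0"
    \<comment> \<open>Applied to \<open>\<eta>\<close>, the operator
      \<open>rank1 g h = \<Phi> b\<close> gives a multiple of \<open>g\<close> on the one hand and a
      vector of the copy, indexed by \<open>b (delta x)\<close>, on the other. The factor
      \<open>l2_inner h \<eta>\<close> is the nonzero squared norm of \<open>\<eta>\<close>.\<close>
    have Hw: "l2_inner w g = 0" if g: "g \<in> H" for g
    proof -
      obtain b where b: "b \<in> roe_alg" "rank1 g h = \<Phi> b"
        using sub rank1_compacts_on[OF H g h(1)] by blast
      define \<eta> where "\<eta> = \<Phi> (e x) h"
      have "\<Phi> b \<eta> = \<Phi> (rank1 (b (delta x)) (delta x)) h"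
        using b(1) unfolding \<eta>_def by (simp add: phi_comp_apply comp_rank1)
      moreover have "\<Phi> b \<eta> = vscale (l2_inner h \<eta>) g"
        using hl by (simp add: \<eta>_def flip: b(2))
      ultimately have "l2_inner (vscale (l2_inner h \<eta>) g) w = 0"
        using orth[of "b (delta x)"] b(1) by simp
      moreover have "l2_inner h \<eta> \<noteq> 0"
        using phi_e_norm_square[OF hl, of x] x hl by (simp add: \<eta>_def)
      ultimately have "l2_inner g w = 0" by (simp add: l2_inner_scale_left)
      thus ?thesis by (subst l2_inner_commute) simp
    qed
    \<comment> \<open>As \<open>w\<close> is orthogonal to \<open>H\<close>, this operator kills the
      range of every compact operator on \<open>H\<close>, and essentiality applies.\<close>
    have "rank1 w w = 0"
    proof (rule annih)
      show "rank1 w w \<in> ?D" using w by (rule rank1_self_hereditary_gen)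
      fix j assume j: "j \<in> compacts_on H"
      hence jb: "bounded_op j" by (simp add: compacts_on_def)
      show "rank1 w w \<circ> j = 0"
      proof (rule bounded_op_eqI)
        fix f :: "'y vec" assume f: "f \<in> l2"
        hence "j f \<in> H" using j by (auto simp: compacts_on_def)
        thus "(rank1 w w \<circ> j) f = 0 f" using Hw jb by simp
      qed (use jb w in auto)
    qed
    thus "w = 0" using w by (intro rank1_self_eq_0D)
  qed
qed

end

theorem theorem5p3:
  fixes \<Phi> :: "('x::metric_space, 'x) op \<Rightarrow> ('y::metric_space, 'y) op"
  assumes "unif_locally_finite (UNIV :: 'x set)"
      and "unif_locally_finite (UNIV :: 'y set)"
      and "roe_embedding \<Phi>"
  defines "C1 \<equiv> (\<exists>u :: ('x, 'y) op. l2_isometry u \<and> (\<forall>a\<in>roe_alg. \<Phi> a = u \<circ> a \<circ> adj u))"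
      and "C2 \<equiv> rank_preserving \<Phi> roe_alg \<and> strongly_continuous \<Phi> roe_alg"
      and "C3 \<equiv> (\<forall>k :: ('y, 'y) op. compact_op k \<longrightarrow> \<Phi> id_op \<circ> k \<circ> \<Phi> id_op \<in> \<Phi> ` roe_alg)"
      and "C4 \<equiv> (\<exists>H :: 'y vec set. closed_l2_subspace H \<and> compacts_on H \<subseteq> \<Phi> ` roe_alg \<and>
                  essential_ideal (compacts_on H) (hereditary_gen roe_alg (\<Phi> ` roe_alg)))"
  shows "(C1 \<longleftrightarrow> C2) \<and> (C1 \<longleftrightarrow> C3) \<and> (C1 \<longleftrightarrow> C4)"
proof -
  interpret roe_emb \<Phi> by unfold_locales (rule assms(3))
  \<comment> \<open>\<open>C1\<close> is the hub: it is linked with \<open>C2\<close> in both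
    directions and lies on the cycle through \<open>C3\<close> and \<open>C4\<close>.\<close>
  have "C1 \<Longrightarrow> C2"
    unfolding C1_def C2_def
    using spatial_imp_rank_preserving spatial_imp_strongly_continuous by blast
  moreover have "C2 \<Longrightarrow> C1"
    unfolding C1_def C2_def
    using rank_preserving_strongly_continuous_imp_spatial by blast
  moreover have "C1 \<Longrightarrow> C3"
    unfolding C1_def C3_def using spatial_imp_corner_compacts by blast
  moreover have "C3 \<Longrightarrow> C4"
    unfolding C3_def C4_def by (rule corner_compacts_imp_essential) blast
  moreover have "C4 \<Longrightarrow> C1"
    unfolding C4_def C1_def using essential_imp_spatial by blast
  ultimately show ?thesis by blast
qed

end
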